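(* Let $p\ge 2$, $-\infty\le a<b\le+\infty$, let $h:(0,\infty)\to(0,\infty)$ be a continuous function, let $H:(0,\infty)\to\mathbb{R}$ be a locally absolutely continuous primitive of $h$ and $\mathcal{T}_h:=H/h:(0,\infty)\to\mathbb{R}$. Denote $$G_h(\lambda):=\frac{|\mathcal{T}_h(\lambda)|^{p/2}h(\lambda)}{\lambda^{p/2}},\qquad \mathcal{A}_f:=\{r\in(a,b): f'(r)=0\ \text{or}\ (f(r)\ne 0\ \text{and}\ f'(r)\ne 0)\}$$ (the set $\mathcal{A}_f$ is of full measure in $(a,b)$). Assume further that: (i) each of the two functions $h$ and $|\mathcal{T}_h|^{\frac p2}h$ is either bounded or nonincreasing in some neighborhood of $0$; (ii) if $|\mathcal{T}_h|^{\frac p2}h$ is not nonincreasing near zero, then the function $G_h$ is either nonincreasing or bounded near $0$. Let $\mathcal{R}_G(a,b)$ be the set of all $f\in W^{2,1}_{loc}((a,b))$ such that there exists $\epsilon>0$ with $$\int_{(r,R)\cap\{x:0<|f(x)|<\epsilon\}}|f'(x)|^pG_h(|f(x)|)\,dx<\infty\quad\text{for all } r,R \text{ with } a<r<R<b,$$ and $$\liminf_{R\nearrow b,\,R\in\mathcal{A}_f}|f'(R)|^{p-2}f'(R)\,\mathrm{sign}f(R)\,H(|f(R)|)\chi_{\{R:f(R)\ne 0\}}-\limsup_{r\searrow a,\,r\in\mathcal{A}_f}|f'(r)|^{p-2}f'(r)\,\mathrm{sign}f(r)\,H(|f(r)|)\chi_{\{r:f(r)\ne 0\}}\le 0 .$$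 Then for every $f\in\mathcal{R}_G(a,b)$, $$\int_{(a,b)\cap\{x:f(x)\ne 0\}}|f'(x)|^p h(|f(x)|)\,dx\le\left(\sqrt{p-1}\right)^p\int_{(a,b)\cap\{x:f(x)\ne 0\}}\left|f''(x)\,\mathcal{T}_h(|f(x)|)\right|^{\frac p2}h(|f(x)|)\,dx .$$
   Context: "In some neighborhood of $0$" and "near $0$" mean on some interval $(0,\epsilon]$, $\epsilon>0$. For a function $u$ defined on a set $E$, $u\chi_E$ denotes its extension by zero outside $E$ (so the boundary expressions are $0$ at points where $f=0$). Here $f\in W^{2,1}_{loc}$ is identified with its $C^1$ representative whose derivative $f'$ is locally absolutely continuous; $f''$ is the a.e. defined second derivative. Functions are real valued, and integrals of nonnegative functions are taken in $[0,+\infty]$. *)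

theory Defs
  imports "HOL-Analysis.Analysis"
begin

text \<open>
  The usual epsilon-delta notion for functions of one real variable; a pair \<open>(u, v)\<close> in \<open>D\<close>
  stands for the interval with end points \<open>u\<close> and \<open>v\<close>.  (The constant
  \<^const>\<open>absolutely_continuous\<close> of the library is about measures.)
\<close>
definition AC_on :: "real set \<Rightarrow> (real \<Rightarrow> real) \<Rightarrow> bool" where
  "AC_on S u \<longleftrightarrow>
     (\<forall>\<epsilon>>0. \<exists>\<delta>>0. \<forall>D :: (real \<times> real) set.
        finite D \<and> (\<forall>(s, t)\<in>D. s < t \<and> {s..t} \<subseteq> S)
          \<and> disjoint_family_on (\<lambda>(s, t). {s<..<t}) D
          \<and> (\<Sum>(s, t)\<in>D. t - s) < \<delta>
        \<longrightarrow> (\<Sum>(s, t)\<in>D. \<bar>u t - u s\<bar>) < \<epsilon>)"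

definition locally_AC_on :: "real set \<Rightarrow> (real \<Rightarrow> real) \<Rightarrow> bool" where
  "locally_AC_on S u \<longleftrightarrow> (\<forall>c d. c \<le> d \<and> {c..d} \<subseteq> S \<longrightarrow> AC_on {c..d} u)"

definition AC_primitive_on :: "real set \<Rightarrow> (real \<Rightarrow> real) \<Rightarrow> (real \<Rightarrow> real) \<Rightarrow> bool" where
  "AC_primitive_on S h H \<longleftrightarrow>
     locally_AC_on S H \<and> (AE x in lebesgue. x \<in> S \<longrightarrow> (H has_real_derivative h x) (at x))"

text \<open>
  The Sobolev space \<open>W\<^sup>2\<^sup>,\<^sup>1\<^sub>l\<^sub>o\<^sub>c\<close> on an open interval \<open>I\<close>, each class being
  represented by its continuously differentiable member (continuity of the derivative is part of
  its local absolute continuity).  Values of \<open>f\<close> outside \<open>I\<close> play no role.  The derivatives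
  \<open>f'\<close> and \<open>f''\<close> are \<open>deriv f\<close> and \<open>deriv (deriv f)\<close>; the latter is meaningful almost
  everywhere on \<open>I\<close>.
\<close>
definition W21_loc :: "real set \<Rightarrow> (real \<Rightarrow> real) set" where
  "W21_loc I = {f. (\<forall>x\<in>I. f differentiable (at x)) \<and> locally_AC_on I (deriv f)}"

definition bounded_near_0 :: "(real \<Rightarrow> real) \<Rightarrow> bool" where
  "bounded_near_0 u \<longleftrightarrow> (\<exists>\<epsilon>>0. bounded (u ` {0<..\<epsilon>}))"

definition nonincreasing_near_0 :: "(real \<Rightarrow> real) \<Rightarrow> bool" where
  "nonincreasing_near_0 u \<longleftrightarrow> (\<exists>\<epsilon>>0. antimono_on {0<..\<epsilon>} u)"

text \<open>
  The transform \<open>\<T>\<^sub>h = H / h\<close> depends on the chosen primitive, so \<open>H\<close> is an argument here and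
  below.  Only arguments in the open half line \<open>(0, \<infinity>)\<close> are relevant.
\<close>
definition T_trans :: "(real \<Rightarrow> real) \<Rightarrow> (real \<Rightarrow> real) \<Rightarrow> real \<Rightarrow> real" where
  "T_trans h H l = H l / h l"

definition G_fun :: "real \<Rightarrow> (real \<Rightarrow> real) \<Rightarrow> (real \<Rightarrow> real) \<Rightarrow> real \<Rightarrow> real" where
  "G_fun p h H l = \<bar>T_trans h H l\<bar> powr (p / 2) * h l / l powr (p / 2)"

definition A_set :: "ereal \<Rightarrow> ereal \<Rightarrow> (real \<Rightarrow> real) \<Rightarrow> real set" where
  "A_set a b f = {r \<in> einterval a b. deriv f r = 0 \<or> (f r \<noteq> 0 \<and> deriv f r \<noteq> 0)}"

text \<open>
  For \<open>p = 2\<close> and \<open>f' = 0\<close> the library value \<open>0 powr 0 = 0\<close> is harmless because of the factor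
  \<open>f'\<close>.  The indicator discards the irrelevant value \<open>H 0\<close>.
\<close>
definition boundary_term :: "real \<Rightarrow> (real \<Rightarrow> real) \<Rightarrow> (real \<Rightarrow> real) \<Rightarrow> real \<Rightarrow> real" where
  "boundary_term p H f r =
     \<bar>deriv f r\<bar> powr (p - 2) * deriv f r * sgn (f r) * H \<bar>f r\<bar> * indicator {x. f x \<noteq> 0} r"

text \<open>
  The one-sided filters at the possibly infinite end points are pulled back from the extended
  reals and restricted to the set \<open>A_set a b f\<close>.  The lower and upper limits are extended reals.
  Both \<open>\<infinity> - \<infinity>\<close> and \<open>- \<infinity> - (- \<infinity>)\<close> evaluate to \<open>\<infinity>\<close> there, so the inequality below
  fails whenever the difference is undefined.
\<close>
definition R_class ::
    "real \<Rightarrow> (real \<Rightarrow> real) \<Rightarrow> (real \<Rightarrow> real) \<Rightarrow> ereal \<Rightarrow> ereal \<Rightarrow> (real \<Rightarrow> real) set" where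
  "R_class p h H a b =
     {f \<in> W21_loc (einterval a b).
        (\<exists>\<epsilon>>0. \<forall>r R. a < ereal r \<and> r < R \<and> ereal R < b \<longrightarrow>
           (\<integral>\<^sup>+ x \<in> {r<..<R} \<inter> {x. 0 < \<bar>f x\<bar> \<and> \<bar>f x\<bar> < \<epsilon>}.
              ennreal (\<bar>deriv f x\<bar> powr p * G_fun p h H \<bar>f x\<bar>) \<partial>lebesgue) < \<infinity>)
      \<and> Liminf (inf (filtercomap ereal (at_left b)) (principal (A_set a b f)))
            (\<lambda>R. ereal (boundary_term p H f R))
          - Limsup (inf (filtercomap ereal (at_right a)) (principal (A_set a b f)))
            (\<lambda>r. ereal (boundary_term p H f r)) \<le> 0}"

end

theory Submission
  imports Defs
begin

text \<open>
  Write \<open>\<Psi> s = sgn s * H \<bar>s\<bar>\<close>.  Where \<open>f \<noteq> 0\<close>, the function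
  \<open>\<Phi> = \<bar>f'\<bar> powr (p - 2) * f' * \<Psi> f\<close>, which is the boundary term, has the derivative
  \<open>\<bar>f'\<bar> powr p * h \<bar>f\<bar> + (p - 1) * \<bar>f'\<bar> powr (p - 2) * f'' * \<Psi> f\<close>.
  As \<open>\<bar>\<Psi> f\<bar> = \<bar>T \<bar>f\<bar>\<bar> * h \<bar>f\<bar>\<close> with \<open>T = H / h\<close>, Young's inequality with the exponents
  \<open>p / (p - 2)\<close> and \<open>p / 2\<close> bounds the second summand, pointwise, by
  \<open>1 - 2 / p\<close> times the integrand of the left-hand side plus \<open>2 / p\<close> times
  \<open>(p - 1) powr (p / 2)\<close> times the integrand of the right-hand side.  If \<open>\<Phi>\<close> were absolutely continuous, then
  integrating over \<open>{r..R}\<close> and multiplying by \<open>p / 2\<close> would bound the integral of the left-hand side by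
  \<open>p / 2 * (\<Phi> R - \<Phi> r)\<close> plus \<open>(p - 1) powr (p / 2)\<close> times that of the right-hand side.  By the
  boundary condition \<open>\<Phi> R - \<Phi> r\<close> is as small as desired for suitable \<open>r\<close> near \<open>a\<close> and
  \<open>R\<close> near \<open>b\<close>, and the constant is the one claimed, since
  \<open>sqrt (p - 1) powr p = (p - 1) powr (p / 2)\<close>.

  The obstacle is the set of zeros of \<open>f\<close>, where \<open>\<Psi>\<close> may be discontinuous or unbounded.  Therefore \<open>\<Psi>\<close>
  is multiplied by the factor \<open>(1 - \<delta> / \<bar>s\<bar>) powr p\<close>, set to \<open>0\<close> for \<open>\<bar>s\<bar> \<le> \<delta>\<close>.  The
  product is continuously differentiable on the whole line, and the derivative of the factor contributes an
  error that is at most \<open>\<tau>\<close> times the cut-off integrand of the left-hand side plus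
  \<open>C \<tau> * \<bar>f'\<bar> powr p * G \<bar>f\<bar> * (\<delta> / \<bar>f\<bar>)\<close> on \<open>\<bar>f\<bar> > \<delta>\<close> (lemma
  \<open>H_cutoff'_le\<close>).  In a compact subinterval of \<open>(a, b)\<close> the function
  \<open>\<bar>f'\<bar> powr p * G \<bar>f\<bar>\<close> is integrable over the set where \<open>0 < \<bar>f\<bar> < \<epsilon>\<close>, by the condition
  on \<open>G\<close> in the definition of the class of functions, and bounded where \<open>\<bar>f\<bar> \<ge> \<epsilon>\<close>, so this part of
  the error tends to \<open>0\<close> with \<open>\<delta>\<close> by dominated convergence.  Since Young's inequality is applied pointwise and the cut-off
  integrals are finite, no prior knowledge about the finiteness of the left-hand side is needed.

  Integrating \<open>\<Phi>'\<close> requires that absolutely continuous functions are differentiable almost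
  everywhere and satisfy the fundamental theorem of calculus.  The former is proved for functions of bounded
  variation by Vitali's covering theorem, the latter with the Henstock--Kurzweil integral.
\<close>

section \<open>Nonoverlapping families of intervals and bounded variation\<close>

text \<open>
  The families of intervals that occur in the definition of absolute continuity: a pair \<open>(s, t)\<close>
  stands for \<open>{s..t}\<close>, and distinct members may share end points but no interior points.
\<close>

definition nonoverlapping :: "real set \<Rightarrow> (real \<times> real) set \<Rightarrow> bool" where
  "nonoverlapping S D \<longleftrightarrow>
     finite D \<and> (\<forall>(s, t)\<in>D. s < t \<and> {s..t} \<subseteq> S)
       \<and> disjoint_family_on (\<lambda>(s, t). {s<..<t}) D"

text \<open>
  The sum of the absolute increments of \<open>u\<close> over such a family.
\<close>

definition increments :: "(real \<Rightarrow> real) \<Rightarrow> (real \<times> real) set \<Rightarrow> real" where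
  "increments u D = (\<Sum>(s, t)\<in>D. \<bar>u t - u s\<bar>)"

lemma nonoverlapping_finite: "nonoverlapping S D \<Longrightarrow> finite D"
  by (simp add: nonoverlapping_def)

lemma nonoverlapping_cases:
  assumes "nonoverlapping S D" "(s, t) \<in> D" "(s', t') \<in> D" "(s, t) \<noteq> (s', t')"
  shows "t \<le> s' \<or> t' \<le> s"
proof (rule ccontr)
  assume "\<not> (t \<le> s' \<or> t' \<le> s)"
  moreover have "s < t" "s' < t'" using assms by (auto simp: nonoverlapping_def)
  ultimately have "(max s s' + min t t') / 2 \<in> {s<..<t} \<inter> {s'<..<t'}"
    by auto
  moreover have "{s<..<t} \<inter> {s'<..<t'} = {}"
    using assms unfolding nonoverlapping_def disjoint_family_on_def by blast
  ultimately show False by blast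
qed

lemma nonoverlappingI:
  assumes "finite D" "\<And>s t. (s, t) \<in> D \<Longrightarrow> s < t \<and> {s..t} \<subseteq> S"
    and "\<And>s t s' t'. (s, t) \<in> D \<Longrightarrow> (s', t') \<in> D \<Longrightarrow> (s, t) \<noteq> (s', t') \<Longrightarrow> t \<le> s' \<or> t' \<le> s"
  shows "nonoverlapping S D"
proof -
  have "{s<..<t} \<inter> {s'<..<t'} = {}"
    if "(s, t) \<in> D" "(s', t') \<in> D" "(s, t) \<noteq> (s', t')" for s t s' t'
    using assms(3)[OF that] by auto
  then show ?thesis
    using assms(1,2) unfolding nonoverlapping_def disjoint_family_on_def by blast
qed

lemma nonoverlappingD:
  assumes "nonoverlapping S D" "(s, t) \<in> D"
  shows "s < t" "{s..t} \<subseteq> S"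
  using assms unfolding nonoverlapping_def by blast+

lemma nonoverlapping_IccD:
  assumes "nonoverlapping {c..d} D" "(s, t) \<in> D"
  shows "s < t" "c \<le> s" "t \<le> d"
  using nonoverlappingD[OF assms] by auto

lemma nonoverlapping_mono:
  assumes "nonoverlapping S D" "D' \<subseteq> D" "\<And>s t. (s, t) \<in> D' \<Longrightarrow> {s..t} \<subseteq> S'"
  shows "nonoverlapping S' D'"
proof (rule nonoverlappingI)
  show "finite D'" using assms(1,2) nonoverlapping_finite finite_subset by blast
  show "s < t \<and> {s..t} \<subseteq> S'" if "(s, t) \<in> D'" for s t
    using that assms(2) by (intro conjI assms(3) nonoverlappingD(1)[OF assms(1)]) blast+
  show "t \<le> s' \<or> t' \<le> s"
    if "(s, t) \<in> D'" "(s', t') \<in> D'" "(s, t) \<noteq> (s', t')" for s t s' t'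
    using that assms(2) by (intro nonoverlapping_cases[OF assms(1)]) blast+
qed

lemma sum_increments_le:
  fixes F :: "real \<Rightarrow> real"
  assumes "nonoverlapping {c..d} D" "c \<le> d" "mono_on {c..d} F"
  shows "(\<Sum>(s, t)\<in>D. F t - F s) \<le> F d - F c"
  using assms
proof (induction "card D" arbitrary: D d)
  case 0
  then have "D = {}" by (simp add: nonoverlapping_def)
  with 0 show ?case by (auto simp: mono_on_def)
next
  case (Suc n)
  have fin: "finite D" using Suc.prems by (simp add: nonoverlapping_def)
  have "D \<noteq> {}" using Suc.hyps by auto
  define m where "m = Max (fst ` D)"
  have "m \<in> fst ` D" unfolding m_def using fin \<open>D \<noteq> {}\<close> by (intro Max_in) auto
  then obtain q where mq: "(m, q) \<in> D" by force
  note D = nonoverlapping_IccD[OF Suc.prems(1)]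
  have le: "t \<le> m" if "(s, t) \<in> D - {(m, q)}" for s t
  proof -
    have "s \<le> m" unfolding m_def using fin that by (force intro!: Max_ge)
    moreover have "t \<le> m \<or> q \<le> s"
      using nonoverlapping_cases[OF Suc.prems(1) _ mq, of s t] that by auto
    ultimately show ?thesis using D[OF mq] by auto
  qed
  have "nonoverlapping {c..m} (D - {(m, q)})"
    proof (rule nonoverlapping_mono[OF Suc.prems(1)])
    show "{s..t} \<subseteq> {c..m}" if "(s, t) \<in> D - {(m, q)}" for s t
      using le[OF that] D[of s t] that by auto
  qed auto
  moreover have "mono_on {c..m} F"
    using Suc.prems(3) D[OF mq] by (auto simp: mono_on_def)
  moreover have "n = card (D - {(m, q)})" using Suc.hyps mq fin by simp
  ultimately have "(\<Sum>(s, t)\<in>D - {(m, q)}. F t - F s) \<le> F m - F c"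
    using Suc.hyps(1) D[OF mq] by blast
  moreover have "(\<Sum>(s, t)\<in>D. F t - F s) = (F q - F m) + (\<Sum>(s, t)\<in>D - {(m, q)}. F t - F s)"
    using fin mq by (simp add: sum.remove)
  moreover have "F q \<le> F d"
    using Suc.prems(3) D[OF mq] by (auto simp: mono_on_def)
  ultimately show ?case by simp
qed

text \<open>
  The total variation of \<open>u\<close> on \<open>{c..x}\<close>.  The supremum is meaningful only under
  \<open>bounded_variation\<close> below.  The families need not fill \<open>{c..x}\<close>; this gives the same supremum as
  partitions and makes superadditivity (lemma \<open>variation_increment\<close>) immediate.
\<close>

definition variation :: "(real \<Rightarrow> real) \<Rightarrow> real \<Rightarrow> real \<Rightarrow> real" where
  "variation u c x = (SUP D\<in>{D. nonoverlapping {c..x} D}. increments u D)"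

text \<open>
  On \<open>{c..d}\<close>; the increments of \<open>u\<close> over nonoverlapping families have a common upper bound.
\<close>

definition bounded_variation :: "real \<Rightarrow> real \<Rightarrow> (real \<Rightarrow> real) \<Rightarrow> bool" where
  "bounded_variation c d u \<longleftrightarrow> bdd_above (increments u ` {D. nonoverlapping {c..d} D})"

lemma increments_le_variation:
  assumes "bounded_variation c d u" "nonoverlapping {c..d} D"
  shows "increments u D \<le> variation u c d"
  unfolding variation_def
  using assms unfolding bounded_variation_def by (intro cSUP_upper) auto

lemma bounded_variation_subset:
  assumes "bounded_variation c d u" "c \<le> c'" "d' \<le> d"
  shows "bounded_variation c' d' u"
  unfolding bounded_variation_def
proof (rule bdd_above_mono)
  show "bdd_above (increments u ` {D. nonoverlapping {c..d} D})"
    using assms by (simp add: bounded_variation_def)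
  show "increments u ` {D. nonoverlapping {c'..d'} D} \<subseteq> increments u ` {D. nonoverlapping {c..d} D}"
    proof (intro image_mono subsetI CollectI, elim CollectE)
    fix D assume "nonoverlapping {c'..d'} D"
    then show "nonoverlapping {c..d} D"
    proof (rule nonoverlapping_mono)
      show "{s..t} \<subseteq> {c..d}" if "(s, t) \<in> D" for s t
        using nonoverlapping_IccD[OF \<open>nonoverlapping {c'..d'} D\<close> that] assms(2,3) by auto
    qed simp
  qed
qed

lemma variation_increment:
  assumes "bounded_variation c d u" "c \<le> x" "x < y" "y \<le> d"
  shows "variation u c x + \<bar>u y - u x\<bar> \<le> variation u c y"
proof -
  have y: "bounded_variation c y u"
    using bounded_variation_subset[OF assms(1)] assms by auto
  have "increments u D \<le> variation u c y - \<bar>u y - u x\<bar>" if "nonoverlapping {c..x} D" for D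
  proof -
    note D = nonoverlapping_IccD[OF that]
    have "nonoverlapping {c..y} (insert (x, y) D)"
    proof (rule nonoverlappingI)
      show "finite (insert (x, y) D)" using that by (simp add: nonoverlapping_def)
      show "s < t \<and> {s..t} \<subseteq> {c..y}" if "(s, t) \<in> insert (x, y) D" for s t
        using that D[of s t] assms(2,3) by auto
      show "t \<le> s' \<or> t' \<le> s" if "(s, t) \<in> insert (x, y) D" "(s', t') \<in> insert (x, y) D"
        "(s, t) \<noteq> (s', t')" for s t s' t'
        using that D(3)[of s t] D(3)[of s' t'] nonoverlapping_cases[OF \<open>nonoverlapping {c..x} D\<close>, of s t s' t']
        by blast
    qed
    from increments_le_variation[OF y this] show ?thesis
      using D(3)[of x y] assms(3) nonoverlapping_finite[OF that] unfolding increments_def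
      by (subst (asm) sum.insert) (auto simp: not_le)
  qed
  moreover have "nonoverlapping {c..x} {}" by (simp add: nonoverlapping_def disjoint_family_on_def)
  ultimately have "variation u c x \<le> variation u c y - \<bar>u y - u x\<bar>"
    unfolding variation_def[of u c x] by (intro cSUP_least) auto
  then show ?thesis by simp
qed

lemma variation_nonneg:
  assumes "bounded_variation c d u"
  shows "0 \<le> variation u c d"
  using increments_le_variation[OF assms, of "{}"]
  by (simp add: increments_def nonoverlapping_def disjoint_family_on_def)

section \<open>Functions of bounded variation are differentiable almost everywhere\<close>

text \<open>
  Vitali's covering theorem in the form used below: if the intervals of \<open>K\<close> cover \<open>E\<close> in the
  sense of Vitali and the total length of finitely many nonoverlapping members is at most \<open>B\<close>,
  then \<open>E\<close> has outer measure at most \<open>B\<close>.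
\<close>

lemma Vitali_cover_bound:
  fixes E :: "real set" and K :: "(real \<times> real) set"
  assumes K: "\<And>s t. (s, t) \<in> K \<Longrightarrow> s < t"
    and cover: "\<And>x e. x \<in> E \<Longrightarrow> e > 0 \<Longrightarrow> \<exists>(s, t)\<in>K. s \<le> x \<and> x \<le> t \<and> t - s < e"
    and bound: "\<And>F. nonoverlapping UNIV F \<Longrightarrow> F \<subseteq> K \<Longrightarrow> (\<Sum>(s, t)\<in>F. t - s) \<le> B"
  obtains T where "E \<subseteq> T" "T \<in> lmeasurable" "measure lebesgue T \<le> B"
proof -
  define a where "a = (\<lambda>(s, t). (s + t) / 2 :: real)"
  define r where "r = (\<lambda>(s, t). (t - s) / 2 :: real)"
  have cb: "cball (a (s, t)) (r (s, t)) = {s..t}" for s t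
    by (simp add: a_def r_def cball_eq_atLeastAtMost field_simps)
  obtain C where C: "countable C" "C \<subseteq> K"
     "pairwise (\<lambda>i j. disjnt (cball (a i) (r i)) (cball (a j) (r j))) C"
     "negligible (E - (\<Union>i \<in> C. cball (a i) (r i)))"
  proof (rule Vitali_covering_theorem_cballs[of K r E a])
    show "0 < r i" if "i \<in> K" for i
    proof (cases i)
      case (Pair s t)
      with that K[of s t] show ?thesis by (simp add: r_def)
    qed
    show "\<exists>i. i \<in> K \<and> x \<in> cball (a i) (r i) \<and> r i < d" if "x \<in> E" "0 < d" for x d
    proof -
      from cover[OF that] obtain s t where "(s, t) \<in> K" "s \<le> x" "x \<le> t" "t - s < d" by auto
      moreover from this have "r (s, t) < d" using K[of s t] by (simp add: r_def)
      ultimately show ?thesis by (intro exI[of _ "(s, t)"]) (simp add: cb)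
    qed
  qed
  have bnd: "measure lebesgue (\<Union>i\<in>F. cball (a i) (r i)) \<le> B" if "F \<subseteq> C" "finite F" for F
  proof -
    have FK: "F \<subseteq> K" using \<open>F \<subseteq> C\<close> C(2) by (rule subset_trans)
    have less: "s < t" if "(s, t) \<in> F" for s t
      using that FK by (intro K) (rule subsetD)
    have disj: "disjnt {s..t} {s'..t'}" if "(s, t) \<in> F" "(s', t') \<in> F" "(s, t) \<noteq> (s', t')" for s t s' t'
      using pairwiseD[OF C(3) _ _ that(3)] that(1,2) \<open>F \<subseteq> C\<close> unfolding cb by blast
    have no: "nonoverlapping UNIV F"
    proof (rule nonoverlappingI)
      show "t \<le> s' \<or> t' \<le> s" if "(s, t) \<in> F" "(s', t') \<in> F" "(s, t) \<noteq> (s', t')" for s t s' t'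
      proof (rule ccontr)
        assume "\<not> (t \<le> s' \<or> t' \<le> s)"
        then have "max s s' \<in> {s..t} \<inter> {s'..t'}"
          using less[OF that(1)] less[OF that(2)] by auto
        then show False using disj[OF that] unfolding disjnt_def by blast
      qed
    qed (simp_all add: that less)
    have "measure lebesgue (\<Union>i\<in>F. cball (a i) (r i)) \<le> (\<Sum>i\<in>F. measure lebesgue (cball (a i) (r i)))"
      using that(2) by (intro measure_UNION_le) auto
    also have "\<dots> = (\<Sum>(s, t)\<in>F. t - s)"
    proof (rule sum.cong[OF refl], clarify)
      show "measure lebesgue (cball (a (s, t)) (r (s, t))) = t - s" if "(s, t) \<in> F" for s t
        unfolding cb using less[OF that] by simp
    qed
    also have "\<dots> \<le> B" by (rule bound[OF no FK])
    finally show ?thesis .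
  qed
  define U where "U = (\<Union>i\<in>C. cball (a i) (r i))"
  have U: "U \<in> lmeasurable"
    unfolding U_def by (rule fmeasurable_UN_bound[OF C(1) _ bnd]) simp_all
  have UB: "measure lebesgue U \<le> B"
    unfolding U_def by (rule measure_UN_bound[OF C(1) _ bnd]) simp_all
  have null: "E - U \<in> null_sets lebesgue"
    using C(4) unfolding U_def by (simp add: negligible_iff_null_sets)
  show thesis
  proof (rule that)
    show "E \<subseteq> U \<union> (E - U)" by auto
    show "U \<union> (E - U) \<in> lmeasurable"
      using U null by (intro fmeasurable.Un) (auto intro: fmeasurableI_null_sets)
    show "measure lebesgue (U \<union> (E - U)) \<le> B"
      using UB U null by (simp add: measure_Un_null_set fmeasurableD del: Un_Diff_cancel)
  qed
qed

text \<open>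
  Points at which \<open>u\<close> has both slopes at most \<open>- \<beta>\<close> and slopes at least \<open>\<beta>\<close> at arbitrarily small
  scales.  Let \<open>D\<close> be a family whose increments come within \<open>\<epsilon> * \<beta>\<close> of the total variation, and
  cover the set by small intervals that lie inside one member of \<open>D\<close>, with the slope opposite to the
  increment of \<open>u\<close> over that member, or outside all members.  Every such interval of length \<open>\<ell>\<close>
  raises the variation that \<open>D\<close> detects by at least \<open>\<beta> * \<ell>\<close>, so their total length is at most \<open>\<epsilon>\<close>.
\<close>

lemma oscillating_increments_negligible:
  fixes u :: "real \<Rightarrow> real"
  assumes bv: "bounded_variation c d u" and "c \<le> d" and "\<beta> > 0"
    and E: "E \<subseteq> {c<..<d}"
    and down: "\<And>x e. x \<in> E \<Longrightarrow> e > 0 \<Longrightarrow>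
                 \<exists>s t. s \<le> x \<and> x \<le> t \<and> s < t \<and> t - s < e \<and> u t - u s \<le> - \<beta> * (t - s)"
    and up: "\<And>x e. x \<in> E \<Longrightarrow> e > 0 \<Longrightarrow>
                 \<exists>s t. s \<le> x \<and> x \<le> t \<and> s < t \<and> t - s < e \<and> u t - u s \<ge> \<beta> * (t - s)"
  shows "negligible E"
  unfolding negligible_outer_le
proof (intro allI impI)
  fix \<epsilon> :: real assume "\<epsilon> > 0"
  define v where "v = variation u c"
  have v: "\<bar>u y - u x\<bar> \<le> v y - v x" if "c \<le> x" "x \<le> y" "y \<le> d" for x y
    using variation_increment[OF bv, of x y] that unfolding v_def
    by (cases "x = y") auto
  have "v d - \<epsilon> * \<beta> < v d" using \<open>\<epsilon> > 0\<close> \<open>\<beta> > 0\<close> by simp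
  moreover have "nonoverlapping {c..d} {}"
    by (simp add: nonoverlapping_def disjoint_family_on_def)
  ultimately obtain D where D: "nonoverlapping {c..d} D" and Dv: "v d - \<epsilon> * \<beta> < increments u D"
    using bv less_cSUP_iff[of "{D. nonoverlapping {c..d} D}" "increments u"]
    unfolding bounded_variation_def v_def variation_def by blast
  note D_bounds = nonoverlapping_IccD[OF D]
  have finD: "finite D" using D by (rule nonoverlapping_finite)
  define ends where "ends = fst ` D \<union> snd ` D"
  define inner where "inner = (\<lambda>p q s t. p < s \<and> t < q
      \<and> (if u p \<le> u q then u t - u s \<le> - \<beta> * (t - s) else u t - u s \<ge> \<beta> * (t - s)))"
  define K where "K = {(s, t). c < s \<and> s < t \<and> t < d \<and>
      ((\<exists>(p, q)\<in>D. inner p q s t)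
        \<or> ((\<forall>(p, q)\<in>D. t < p \<or> q < s) \<and> u t - u s \<ge> \<beta> * (t - s)))}"
  obtain T where T: "E - ends \<subseteq> T" "T \<in> lmeasurable" "measure lebesgue T \<le> \<epsilon>"
  proof (rule Vitali_cover_bound[of K "E - ends" \<epsilon>])
    show "s < t" if "(s, t) \<in> K" for s t using that by (simp add: K_def)
  next
    fix x e :: real assume x: "x \<in> E - ends" and "e > 0"
    have xcd: "c < x" "x < d" using x E by auto
    consider (inside) p q where "(p, q) \<in> D" "p < x" "x < q"
      | (outside) "\<And>p q. (p, q) \<in> D \<Longrightarrow> x < p \<or> q < x"
      using x unfolding ends_def by force
    then show "\<exists>(s, t)\<in>K. s \<le> x \<and> x \<le> t \<and> t - s < e"
    proof cases
      case inside
      define e' where "e' = Min {e, x - p, q - x}"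
      have e': "e' > 0" "e' \<le> e" "e' \<le> x - p" "e' \<le> q - x"
        using inside \<open>e > 0\<close> by (auto simp: e'_def)
      obtain s t where "s \<le> x" "x \<le> t" "s < t" "t - s < e'"
        "if u p \<le> u q then u t - u s \<le> - \<beta> * (t - s) else u t - u s \<ge> \<beta> * (t - s)"
        using down[of x e'] up[of x e'] x e'(1) by (cases "u p \<le> u q") auto
      moreover from this have "p < s" "t < q" using e' by linarith+
      ultimately show ?thesis
        using inside(1) D_bounds[OF inside(1)] e'(2)
        by (intro bexI[of _ "(s, t)"]) (auto simp: K_def inner_def)
    next
      case outside
      have ev: "eventually (\<lambda>e'. \<forall>(p, q)\<in>D. e' \<le> p - x \<or> e' \<le> x - q) (at_right 0)"
        using finD
      proof (subst eventually_ball_finite_distrib, simp, safe)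
        fix p q assume "(p, q) \<in> D"
        then have "max (p - x) (x - q) > 0" using outside by fastforce
        then have "eventually (\<lambda>e'. e' < max (p - x) (x - q)) (at_right 0)"
          by (simp add: eventually_at_right_less eventually_at_right_real eventually_at_right_field)
             blast
        then show "\<forall>\<^sub>F e' in at_right 0. e' \<le> p - x \<or> e' \<le> x - q"
          by eventually_elim auto
      qed
      then obtain e1 where "e1 > 0" "\<And>y. 0 < y \<Longrightarrow> y < e1 \<Longrightarrow> (\<forall>(p, q)\<in>D. y \<le> p - x \<or> y \<le> x - q)"
        unfolding eventually_at_right_field by blast
      note e1 = this
      define e' where "e' = min (min e (e1 / 2)) (min (x - c) (d - x))"
      have e': "e' > 0" "e' \<le> e" "e' \<le> e1 / 2" "e' \<le> x - c" "e' \<le> d - x"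
        using xcd \<open>e > 0\<close> \<open>e1 > 0\<close> unfolding e'_def by linarith+
      obtain s t where st: "s \<le> x" "x \<le> t" "s < t" "t - s < e'" "u t - u s \<ge> \<beta> * (t - s)"
        using up[of x e'] x e'(1) by auto
      have "t < p \<or> q < s" if "(p, q) \<in> D" for p q
        using e1(2)[of e'] e' st that \<open>e1 > 0\<close> by fastforce
      then show ?thesis
        using st e' by (intro bexI[of _ "(s, t)"]) (auto simp: K_def)
    qed
  next
    fix F assume F: "nonoverlapping UNIV F" "F \<subseteq> K"
    have finF: "finite F" using F(1) by (rule nonoverlapping_finite)
    have FK: "c < s" "s < t" "t < d" if "(s, t) \<in> F" for s t
      using that F(2) by (auto simp: K_def)
    define I where "I = (\<lambda>(p, q). {(s, t)\<in>F. inner p q s t})"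
    define Fo where "Fo = {(s, t)\<in>F. (\<forall>(p, q)\<in>D. t < p \<or> q < s)}"
    have Fo: "u t - u s \<ge> \<beta> * (t - s)" if "(s, t) \<in> Fo" for s t
    proof -
      have "(s, t) \<in> K" using that F(2) by (auto simp: Fo_def)
      moreover have "\<not> inner p q s t" if "(p, q) \<in> D" for p q
        using \<open>(s, t) \<in> Fo\<close> FK[of s t] that unfolding Fo_def inner_def by fastforce
      ultimately show ?thesis by (auto simp: K_def)
    qed
    have F_split: "F \<subseteq> Fo \<union> (\<Union>pq\<in>D. I pq)"
      using F(2) by (fastforce simp: K_def I_def Fo_def)
    have inside: "\<bar>u q - u p\<bar> + \<beta> * (\<Sum>(s, t)\<in>I (p, q). t - s) \<le> v q - v p" if "(p, q) \<in> D" for p q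
    proof -
      define \<sigma> :: real where "\<sigma> = (if u p \<le> u q then 1 else -1)"
      \<comment> \<open>Increasing, and rising by at least twice \<open>\<beta> * (t - s)\<close> on each chosen interval.\<close>
      define w where "w = (\<lambda>x. v x - \<sigma> * u x)"
      have mono: "mono_on {p..q} w"
      proof (rule mono_onI)
        fix x y assume "x \<in> {p..q}" "y \<in> {p..q}" "x \<le> y"
        then show "w x \<le> w y"
          using v[of x y] D_bounds[OF that] by (auto simp: w_def \<sigma>_def abs_le_iff)
      qed
      have II: "(s, t) \<in> F \<and> inner p q s t" if "(s, t) \<in> I (p, q)" for s t
        using that by (simp add: I_def)
      have "nonoverlapping {p..q} (I (p, q))"
        using F(1)
      proof (rule nonoverlapping_mono)
        show "{s..t} \<subseteq> {p..q}" if "(s, t) \<in> I (p, q)" for s t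
          using II[OF that] by (auto simp: inner_def)
      qed (auto simp: I_def)
      then have "(\<Sum>(s, t)\<in>I (p, q). w t - w s) \<le> w q - w p"
        by (rule sum_increments_le) (use D_bounds[OF that] mono in auto)
      moreover have "(\<Sum>(s, t)\<in>I (p, q). \<beta> * (t - s)) \<le> (\<Sum>(s, t)\<in>I (p, q). w t - w s)"
      proof (rule sum_mono, clarify)
        fix s t assume st: "(s, t) \<in> I (p, q)"
        have "\<bar>u t - u s\<bar> \<le> v t - v s"
          using v[of s t] FK[of s t] II[OF st] by auto
        moreover have "0 \<le> \<beta> * (t - s)" using FK[of s t] II[OF st] \<open>\<beta> > 0\<close> by simp
        ultimately show "\<beta> * (t - s) \<le> w t - w s"
          using II[OF st] by (auto simp: w_def \<sigma>_def inner_def split: if_splits)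
      qed
      moreover have "w q - w p = v q - v p - \<bar>u q - u p\<bar>"
        by (auto simp: w_def \<sigma>_def)
      ultimately show ?thesis by (simp add: sum_distrib_left case_prod_unfold)
    qed
    have disj: "D \<inter> Fo = {}"
      using D_bounds by (fastforce simp: Fo_def)
    have "nonoverlapping {c..d} (D \<union> Fo)"
    proof (rule nonoverlappingI)
      show "finite (D \<union> Fo)" using finD finF by (auto simp: Fo_def intro: finite_subset)
      show "s < t \<and> {s..t} \<subseteq> {c..d}" if "(s, t) \<in> D \<union> Fo" for s t
        using that D_bounds[of s t] FK[of s t] by (auto simp: Fo_def)
      fix s t s' t' assume *: "(s, t) \<in> D \<union> Fo" "(s', t') \<in> D \<union> Fo" "(s, t) \<noteq> (s', t')"
      have "t \<le> s' \<or> t' \<le> s" if "(s, t) \<in> Fo" "(s', t') \<in> D" for s t s' t'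
        using that by (force simp: Fo_def)
      moreover have "t \<le> s' \<or> t' \<le> s" if "(s, t) \<in> Fo" "(s', t') \<in> Fo"
        using nonoverlapping_cases[OF F(1), of s t s' t'] *(3) that by (auto simp: Fo_def)
      moreover have "t \<le> s' \<or> t' \<le> s" if "(s, t) \<in> D" "(s', t') \<in> D"
        using nonoverlapping_cases[OF D that *(3)] .
      ultimately show "t \<le> s' \<or> t' \<le> s" using *(1,2) by blast
    qed
    then have "(\<Sum>(s, t)\<in>D \<union> Fo. v t - v s) \<le> v d - v c"
    proof (rule sum_increments_le[OF _ \<open>c \<le> d\<close>])
      show "mono_on {c..d} v"
        by (rule mono_onI) (use v in \<open>fastforce simp: abs_le_iff\<close>)
    qed
    moreover have "(\<Sum>(s, t)\<in>D \<union> Fo. v t - v s) = (\<Sum>(s, t)\<in>D. v t - v s) + (\<Sum>(s, t)\<in>Fo. v t - v s)"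
      using finD finF disj by (intro sum.union_disjoint) (auto simp: Fo_def intro: finite_subset)
    moreover have "(\<Sum>(s, t)\<in>Fo. \<beta> * (t - s)) \<le> (\<Sum>(s, t)\<in>Fo. v t - v s)"
    proof (rule sum_mono, clarify)
      fix s t assume st: "(s, t) \<in> Fo"
      then show "\<beta> * (t - s) \<le> v t - v s"
        using Fo[OF st] v[of s t] FK[of s t] by (auto simp: Fo_def)
    qed
    moreover have "(\<Sum>(p, q)\<in>D. \<bar>u q - u p\<bar> + \<beta> * (\<Sum>(s, t)\<in>I (p, q). t - s)) \<le> (\<Sum>(s, t)\<in>D. v t - v s)"
      by (rule sum_mono) (use inside in auto)
    moreover have "(\<Sum>(p, q)\<in>D. \<bar>u q - u p\<bar> + \<beta> * (\<Sum>(s, t)\<in>I (p, q). t - s))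
        = increments u D + \<beta> * (\<Sum>pq\<in>D. \<Sum>(s, t)\<in>I pq. t - s)"
      by (simp add: increments_def case_prod_unfold sum.distrib sum_distrib_left)
    moreover have "v c \<ge> 0"
      unfolding v_def
      by (rule variation_nonneg) (rule bounded_variation_subset[OF bv], use \<open>c \<le> d\<close> in auto)
    moreover have "(\<Sum>(s, t)\<in>Fo. \<beta> * (t - s)) = \<beta> * (\<Sum>(s, t)\<in>Fo. t - s)"
      by (simp add: case_prod_unfold sum_distrib_left)
    ultimately have "\<beta> * (\<Sum>pq\<in>D. \<Sum>(s, t)\<in>I pq. t - s) + \<beta> * (\<Sum>(s, t)\<in>Fo. t - s) \<le> \<epsilon> * \<beta>"
      using Dv by linarith
    moreover have "(\<Sum>(s, t)\<in>F. t - s) \<le> (\<Sum>(s, t)\<in>Fo. t - s) + (\<Sum>pq\<in>D. \<Sum>(s, t)\<in>I pq. t - s)"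
    proof -
      have FoF: "Fo \<subseteq> F" and IF: "\<And>pq. I pq \<subseteq> F" by (auto simp: Fo_def I_def)
      have nn: "0 \<le> (case st of (s, t) \<Rightarrow> t - s)" if "st \<in> F" for st
        using that FK by (cases st) (auto simp: less_imp_le)
      have F_eq: "F = Fo \<union> (\<Union>pq\<in>D. I pq)" using F_split FoF IF by blast
      have fin: "finite Fo" "finite (\<Union>pq\<in>D. I pq)" "finite (I pq)" for pq
        using finF F_eq finite_subset[OF IF finF] finite_subset[OF FoF finF] by auto
      have "(\<Sum>(s, t)\<in>F. t - s) \<le> (\<Sum>(s, t)\<in>Fo. t - s) + (\<Sum>(s, t)\<in>(\<Union>pq\<in>D. I pq). t - s)"
      proof -
        have "0 \<le> (\<Sum>(s, t)\<in>Fo \<inter> (\<Union>pq\<in>D. I pq). t - s)"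
          using FoF by (intro sum_nonneg nn) auto
        then show ?thesis
          using sum.union_inter[OF fin(1,2), of "\<lambda>(s, t). t - s"] F_eq by simp
      qed
      also have "(\<Sum>(s, t)\<in>(\<Union>pq\<in>D. I pq). t - s) = (\<Sum>pq\<in>D. \<Sum>(s, t)\<in>I pq. t - s)"
      proof (rule sum.UNION_disjoint)
        show "\<forall>i\<in>D. \<forall>j\<in>D. i \<noteq> j \<longrightarrow> I i \<inter> I j = {}"
        proof (intro ballI impI)
          fix i j assume ij: "i \<in> D" "j \<in> D" "i \<noteq> j"
          obtain p q p' q' where pq: "i = (p, q)" "j = (p', q')" by (cases i, cases j)
          have "q \<le> p' \<or> q' \<le> p" using nonoverlapping_cases[OF D] ij pq by blast
          then show "I i \<inter> I j = {}" using FK by (fastforce simp: I_def inner_def pq)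
        qed
      qed (use finD fin in auto)
      finally show ?thesis .
    qed
    ultimately have "\<beta> * (\<Sum>(s, t)\<in>F. t - s) \<le> \<beta> * \<epsilon>"
      using \<open>\<beta> > 0\<close> by (smt (verit) distrib_left mult.commute mult_left_mono)
    then show "(\<Sum>(s, t)\<in>F. t - s) \<le> \<epsilon>" using \<open>\<beta> > 0\<close> by simp
  qed
  have "finite ends" unfolding ends_def using finD by simp
  then have "ends \<in> null_sets lebesgue" by (simp add: negligible_iff_null_sets[symmetric] negligible_finite)
  then have "T \<union> ends \<in> lmeasurable" "measure lebesgue (T \<union> ends) \<le> \<epsilon>"
    using T(2,3) fmeasurable.Un[OF T(2) fmeasurableI_null_sets, of ends]
    by (auto simp: measure_Un_null_set fmeasurableD)
  then show "\<exists>T. E \<subseteq> T \<and> T \<in> lmeasurable \<and> measure lebesgue T \<le> \<epsilon>"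
    using T(1) by blast
qed

text \<open>
  An interval on which the slope exceeds \<open>M\<close> uses up variation \<open>M\<close> times its length, so the points
  with unbounded difference quotients form a null set.
\<close>

lemma unbounded_increments_negligible:
  fixes u :: "real \<Rightarrow> real"
  assumes bv: "bounded_variation c d u"
    and E: "E \<subseteq> {c<..<d}"
    and steep: "\<And>x e M. x \<in> E \<Longrightarrow> e > 0 \<Longrightarrow>
                 \<exists>s t. s \<le> x \<and> x \<le> t \<and> s < t \<and> t - s < e \<and> M * (t - s) \<le> \<bar>u t - u s\<bar>"
  shows "negligible E"
  unfolding negligible_outer_le
proof (intro allI impI)
  fix \<epsilon> :: real assume "\<epsilon> > 0"
  define V where "V = variation u c d"
  have "V \<ge> 0" unfolding V_def using bv by (rule variation_nonneg)
  define M where "M = (V + 1) / \<epsilon>"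
  have "M > 0" using \<open>V \<ge> 0\<close> \<open>\<epsilon> > 0\<close> by (simp add: M_def)
  define K where "K = {(s, t). c < s \<and> s < t \<and> t < d \<and> M * (t - s) \<le> \<bar>u t - u s\<bar>}"
  obtain T where T: "E \<subseteq> T" "T \<in> lmeasurable" "measure lebesgue T \<le> \<epsilon>"
  proof (rule Vitali_cover_bound[of K E \<epsilon>])
    show "s < t" if "(s, t) \<in> K" for s t using that by (simp add: K_def)
  next
    fix x e :: real assume x: "x \<in> E" and "e > 0"
    have xcd: "c < x" "x < d" using x E by auto
    define e' where "e' = min e (min (x - c) (d - x))"
    have e': "e' > 0" "e' \<le> e" "e' \<le> x - c" "e' \<le> d - x"
      using xcd \<open>e > 0\<close> by (auto simp: e'_def)
    obtain s t where "s \<le> x" "x \<le> t" "s < t" "t - s < e'" "M * (t - s) \<le> \<bar>u t - u s\<bar>"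
      using steep[OF x e'(1)] by blast
    then show "\<exists>(s, t)\<in>K. s \<le> x \<and> x \<le> t \<and> t - s < e"
      using e' by (intro bexI[of _ "(s, t)"]) (auto simp: K_def)
  next
    fix F assume F: "nonoverlapping UNIV F" "F \<subseteq> K"
    have FK: "c < s \<and> s < t \<and> t < d \<and> M * (t - s) \<le> \<bar>u t - u s\<bar>" if "(s, t) \<in> F" for s t
      using that F(2) by (auto simp: K_def)
    have "nonoverlapping {c..d} F"
      using F(1)
    proof (rule nonoverlapping_mono)
      show "{s..t} \<subseteq> {c..d}" if "(s, t) \<in> F" for s t using FK[OF that] by auto
    qed simp
    then have "increments u F \<le> V" unfolding V_def by (rule increments_le_variation[OF bv])
    moreover have "M * (\<Sum>(s, t)\<in>F. t - s) \<le> increments u F"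
      unfolding increments_def sum_distrib_left by (rule sum_mono) (use FK in auto)
    ultimately have "M * (\<Sum>(s, t)\<in>F. t - s) \<le> M * \<epsilon>"
      using \<open>\<epsilon> > 0\<close> by (simp add: M_def)
    then show "(\<Sum>(s, t)\<in>F. t - s) \<le> \<epsilon>" using \<open>M > 0\<close> by simp
  qed
  then show "\<exists>T. E \<subseteq> T \<and> T \<in> lmeasurable \<and> measure lebesgue T \<le> \<epsilon>" by blast
qed

lemma bounded_variation_minus_linear:
  assumes bv: "bounded_variation c d u" and "c \<le> d"
  shows "bounded_variation c d (\<lambda>x. u x - \<gamma> * x)"
  unfolding bounded_variation_def bdd_above_def
proof (intro exI ballI)
  fix y assume "y \<in> increments (\<lambda>x. u x - \<gamma> * x) ` {D. nonoverlapping {c..d} D}"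
  then obtain D where D: "nonoverlapping {c..d} D" and y: "y = increments (\<lambda>x. u x - \<gamma> * x) D"
    by blast
  have "y \<le> (\<Sum>(s, t)\<in>D. \<bar>u t - u s\<bar> + \<bar>\<gamma>\<bar> * (t - s))"
    unfolding y increments_def
  proof (rule sum_mono, clarify)
    fix s t assume "(s, t) \<in> D"
    then have "\<bar>\<gamma> * t - \<gamma> * s\<bar> = \<bar>\<gamma>\<bar> * (t - s)"
      using nonoverlapping_IccD(1)[OF D, of s t] by (simp add: abs_mult flip: right_diff_distrib)
    then show "\<bar>u t - \<gamma> * t - (u s - \<gamma> * s)\<bar> \<le> \<bar>u t - u s\<bar> + \<bar>\<gamma>\<bar> * (t - s)" by linarith
  qed
  also have "\<dots> = increments u D + \<bar>\<gamma>\<bar> * (\<Sum>(s, t)\<in>D. t - s)"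
    by (simp add: increments_def case_prod_unfold sum.distrib sum_distrib_left)
  also have "\<dots> \<le> variation u c d + \<bar>\<gamma>\<bar> * (d - c)"
    using increments_le_variation[OF bv D] sum_increments_le[OF D \<open>c \<le> d\<close>, of "\<lambda>x. x"]
    by (intro add_mono mult_left_mono) (auto intro: mono_onI)
  finally show "y \<le> variation u c d + \<bar>\<gamma>\<bar> * (d - c)" .
qed

lemma not_differentiable_cases:
  fixes u :: "real \<Rightarrow> real"
  assumes "\<not> u differentiable (at x)"
    and M: "\<forall>\<^sub>F y in at x. \<bar>(u y - u x) / (y - x)\<bar> \<le> M"
  obtains \<alpha> \<beta> where "\<alpha> \<in> \<rat>" "\<beta> \<in> \<rat>" "\<alpha> < \<beta>"
    "\<exists>\<^sub>F y in at x. (u y - u x) / (y - x) < \<alpha>" "\<exists>\<^sub>F y in at x. (u y - u x) / (y - x) > \<beta>"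
proof -
  define Q where "Q = (\<lambda>y. (u y - u x) / (y - x))"
  define l where "l = Liminf (at x) (\<lambda>y. ereal (Q y))"
  define L where "L = Limsup (at x) (\<lambda>y. ereal (Q y))"
  have "l \<le> L" unfolding l_def L_def by (rule Liminf_le_Limsup) simp
  have "L \<le> ereal M" unfolding L_def
    by (rule Limsup_bounded) (use M in \<open>auto elim!: eventually_mono simp: Q_def abs_le_iff simp del: abs_divide\<close>)
  moreover have "ereal (- M) \<le> l" unfolding l_def
    by (rule Liminf_bounded) (use M in \<open>auto elim!: eventually_mono simp: Q_def abs_le_iff simp del: abs_divide\<close>)
  ultimately have fin: "\<bar>l\<bar> \<noteq> \<infinity>" "\<bar>L\<bar> \<noteq> \<infinity>" using \<open>l \<le> L\<close> by auto
  have "l \<noteq> L"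
  proof
    assume "l = L"
    obtain D where D: "l = ereal D" using fin by auto
    have "((\<lambda>y. ereal (Q y)) \<longlongrightarrow> ereal D) (at x)"
      by (rule Liminf_eq_Limsup) (use D \<open>l = L\<close> in \<open>simp_all add: l_def L_def\<close>)
    then have "(u has_field_derivative D) (at x)"
      by (simp add: has_field_derivative_iff Q_def)
    then show False
      using assms(1) by (meson real_differentiable_def)
  qed
  with \<open>l \<le> L\<close> have "l < L" by simp
  then obtain l' L' where lL: "l = ereal l'" "L = ereal L'" "l' < L'" using fin by (cases l; cases L) auto
  obtain \<alpha> where \<alpha>: "\<alpha> \<in> \<rat>" "l' < \<alpha>" "\<alpha> < L'" using Rats_dense_in_real[OF lL(3)] by blast
  obtain \<beta> where \<beta>: "\<beta> \<in> \<rat>" "\<alpha> < \<beta>" "\<beta> < L'" using Rats_dense_in_real[OF \<alpha>(3)] by blast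
  show thesis
  proof (rule that[OF \<alpha>(1) \<beta>(1,2)])
    show "\<exists>\<^sub>F y in at x. (u y - u x) / (y - x) < \<alpha>"
    proof (rule ccontr)
      assume "\<not> ?thesis"
      then have "ereal \<alpha> \<le> l" unfolding l_def
        by (intro Liminf_bounded) (auto simp: not_frequently not_less Q_def elim!: eventually_mono)
      then show False using \<alpha> lL by simp
    qed
    show "\<exists>\<^sub>F y in at x. (u y - u x) / (y - x) > \<beta>"
    proof (rule ccontr)
      assume "\<not> ?thesis"
      then have "L \<le> ereal \<beta>" unfolding L_def
        by (intro Limsup_bounded) (auto simp: not_frequently not_less Q_def elim!: eventually_mono)
      then show False using \<beta> lL by simp
    qed
  qed
qed

lemma frequently_quotient_interval:
  fixes u :: "real \<Rightarrow> real"
  assumes "\<exists>\<^sub>F y in at x. P ((u y - u x) / (y - x))" "e > 0"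
  shows "\<exists>s t. s \<le> x \<and> x \<le> t \<and> s < t \<and> t - s < e \<and> P ((u t - u s) / (t - s))"
proof -
  have "\<forall>\<^sub>F y in at x. dist y x < e \<and> y \<noteq> x" using assms(2) by (auto simp: eventually_at)
  then have "\<exists>\<^sub>F y in at x. P ((u y - u x) / (y - x)) \<and> dist y x < e \<and> y \<noteq> x"
    using frequently_eventually_conj[OF assms(1), of "\<lambda>y. dist y x < e \<and> y \<noteq> x"]
    by (auto elim!: frequently_elim1)
  then obtain y where y: "P ((u y - u x) / (y - x))" "dist y x < e" "y \<noteq> x"
    using frequently_ex by blast
  show ?thesis
  proof (cases "y < x")
    case True
    moreover have "(u x - u y) / (x - y) = (u y - u x) / (y - x)"
      by (metis minus_diff_eq minus_divide_divide)
    ultimately show ?thesis using y by (intro exI[of _ y] exI[of _ x]) (auto simp: dist_real_def)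
  next
    case False
    then show ?thesis using y by (intro exI[of _ x] exI[of _ y]) (auto simp: dist_real_def)
  qed
qed

text \<open>
  If the difference quotients at \<open>x\<close> are bounded but do not converge, they fall below \<open>\<alpha>\<close> and rise above
  \<open>\<beta>\<close> for some rationals \<open>\<alpha> < \<beta>\<close>.  Subtracting the linear function with the slope
  \<open>\<gamma> = (\<alpha> + \<beta>) / 2\<close> makes the two thresholds symmetric about \<open>0\<close>.
\<close>

theorem bounded_variation_differentiable_ae:
  assumes bv: "bounded_variation c d u"
  shows "negligible {x \<in> {c<..<d}. \<not> u differentiable (at x)}"
proof (cases "c \<le> d")
  case False
  then show ?thesis by simp
next
  case True
  define Q where "Q = (\<lambda>x y. (u y - u x) / (y - x))"
  define S where "S = {x \<in> {c<..<d}. \<forall>M. \<not> (\<forall>\<^sub>F y in at x. \<bar>Q x y\<bar> \<le> M)}"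
  define E where "E = (\<lambda>(\<alpha>, \<beta>). {x \<in> {c<..<d}. (\<exists>\<^sub>F y in at x. Q x y < \<alpha>) \<and> (\<exists>\<^sub>F y in at x. Q x y > \<beta>)})"
  have "negligible S"
  proof (rule unbounded_increments_negligible[OF bv])
    fix x e M :: real assume "x \<in> S" "e > 0"
    then have "\<exists>\<^sub>F y in at x. M \<le> \<bar>(u y - u x) / (y - x)\<bar>"
      by (auto simp: S_def Q_def not_eventually not_le simp del: abs_divide elim!: allE[of _ M] frequently_elim1)
    from frequently_quotient_interval[OF this \<open>e > 0\<close>]
    obtain s t where "s \<le> x" "x \<le> t" "s < t" "t - s < e" "M \<le> \<bar>(u t - u s) / (t - s)\<bar>" by blast
    then show "\<exists>s t. s \<le> x \<and> x \<le> t \<and> s < t \<and> t - s < e \<and> M * (t - s) \<le> \<bar>u t - u s\<bar>"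
      by (intro exI[of _ s] exI[of _ t]) (auto simp: abs_divide field_simps)
  qed (auto simp: S_def)
  moreover have "negligible (E (\<alpha>, \<beta>))" if "\<alpha> < \<beta>" for \<alpha> \<beta>
  proof -
    define \<gamma> where "\<gamma> = (\<alpha> + \<beta>) / 2"
    define \<eta> where "\<eta> = (\<beta> - \<alpha>) / 2"
    show ?thesis
    proof (rule oscillating_increments_negligible[OF bounded_variation_minus_linear[OF bv True, of \<gamma>] True, of \<eta>])
      show "\<eta> > 0" using that by (simp add: \<eta>_def)
      show "E (\<alpha>, \<beta>) \<subseteq> {c<..<d}" by (auto simp: E_def)
      fix x e :: real assume x: "x \<in> E (\<alpha>, \<beta>)" and "e > 0"
      have freq: "\<exists>\<^sub>F y in at x. (u y - u x) / (y - x) < \<alpha>" "\<exists>\<^sub>F y in at x. (u y - u x) / (y - x) > \<beta>"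
        using x by (auto simp: E_def Q_def)
      obtain s t where "s \<le> x" "x \<le> t" "s < t" "t - s < e" "(u t - u s) / (t - s) < \<alpha>"
        using frequently_quotient_interval[OF freq(1) \<open>e > 0\<close>] by blast
      then show "\<exists>s t. s \<le> x \<and> x \<le> t \<and> s < t \<and> t - s < e
          \<and> (u t - \<gamma> * t) - (u s - \<gamma> * s) \<le> - \<eta> * (t - s)"
        by (intro exI[of _ s] exI[of _ t]) (auto simp: \<gamma>_def \<eta>_def field_simps)
      obtain s t where "s \<le> x" "x \<le> t" "s < t" "t - s < e" "(u t - u s) / (t - s) > \<beta>"
        using frequently_quotient_interval[OF freq(2) \<open>e > 0\<close>] by blast
      then show "\<exists>s t. s \<le> x \<and> x \<le> t \<and> s < t \<and> t - s < e
          \<and> (u t - \<gamma> * t) - (u s - \<gamma> * s) \<ge> \<eta> * (t - s)"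
        by (intro exI[of _ s] exI[of _ t]) (auto simp: \<gamma>_def \<eta>_def field_simps)
    qed
  qed
  then have "negligible (\<Union> (E ` {(\<alpha>, \<beta>). \<alpha> \<in> \<rat> \<and> \<beta> \<in> \<rat> \<and> \<alpha> < \<beta>}))"
    by (intro negligible_countable_Union countable_image
          countable_subset[OF _ countable_SIGMA[OF countable_rat countable_rat]]) auto
  ultimately have "negligible (S \<union> \<Union> (E ` {(\<alpha>, \<beta>). \<alpha> \<in> \<rat> \<and> \<beta> \<in> \<rat> \<and> \<alpha> < \<beta>}))"
    by (rule negligible_Un)
  then show ?thesis
  proof (rule negligible_subset, intro subsetI)
    fix x assume "x \<in> {x \<in> {c<..<d}. \<not> u differentiable (at x)}"
    then have x: "x \<in> {c<..<d}" "\<not> u differentiable (at x)" by auto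
    show "x \<in> S \<union> \<Union> (E ` {(\<alpha>, \<beta>). \<alpha> \<in> \<rat> \<and> \<beta> \<in> \<rat> \<and> \<alpha> < \<beta>})"
    proof (cases "x \<in> S")
      case False
      then obtain M where "\<forall>\<^sub>F y in at x. \<bar>(u y - u x) / (y - x)\<bar> \<le> M"
        using x by (auto simp: S_def Q_def)
      from not_differentiable_cases[OF x(2) this] obtain \<alpha> \<beta> where "\<alpha> \<in> \<rat>" "\<beta> \<in> \<rat>" "\<alpha> < \<beta>"
        "\<exists>\<^sub>F y in at x. (u y - u x) / (y - x) < \<alpha>" "\<exists>\<^sub>F y in at x. (u y - u x) / (y - x) > \<beta>" by blast
      then show ?thesis using x(1) by (auto simp: E_def Q_def)
    qed simp
  qed
qed

section \<open>Absolutely continuous functions\<close>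

lemma AC_on_iff:
  "AC_on S u \<longleftrightarrow>
     (\<forall>\<epsilon>>0. \<exists>\<delta>>0. \<forall>D. nonoverlapping S D \<and> (\<Sum>(s, t)\<in>D. t - s) < \<delta> \<longrightarrow> increments u D < \<epsilon>)"
  unfolding AC_on_def nonoverlapping_def increments_def by (simp only: conj_assoc)

lemma AC_on_increment:
  assumes "AC_on S u" "\<epsilon> > 0"
  obtains \<delta> where "\<delta> > 0" "\<And>s t. s \<le> t \<Longrightarrow> {s..t} \<subseteq> S \<Longrightarrow> t - s < \<delta> \<Longrightarrow> \<bar>u t - u s\<bar> < \<epsilon>"
proof -
  obtain \<delta> where \<delta>: "\<delta> > 0"
    "\<And>D. nonoverlapping S D \<Longrightarrow> (\<Sum>(s, t)\<in>D. t - s) < \<delta> \<Longrightarrow> increments u D < \<epsilon>"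
    using assms unfolding AC_on_iff by blast
  show thesis
  proof (rule that[OF \<delta>(1)])
    fix s t assume st: "s \<le> t" "{s..t} \<subseteq> S" "t - s < \<delta>"
    show "\<bar>u t - u s\<bar> < \<epsilon>"
    proof (cases "s = t")
      case False
      then have "nonoverlapping S {(s, t)}"
        using st by (auto simp: nonoverlapping_def disjoint_family_on_def)
      from \<delta>(2)[OF this] st show ?thesis by (simp add: increments_def)
    qed (use assms in simp)
  qed
qed

lemma AC_on_imp_continuous_on:
  assumes "AC_on {c..d} u"
  shows "continuous_on {c..d} u"
  unfolding continuous_on_iff
proof (intro ballI allI impI)
  fix x \<epsilon> :: real assume "x \<in> {c..d}" "\<epsilon> > 0"
  obtain \<delta> where \<delta>: "\<delta> > 0"
    "\<And>s t. s \<le> t \<Longrightarrow> {s..t} \<subseteq> {c..d} \<Longrightarrow> t - s < \<delta> \<Longrightarrow> \<bar>u t - u s\<bar> < \<epsilon>"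
    using AC_on_increment[OF assms \<open>\<epsilon> > 0\<close>] by blast
  have "dist (u y) (u x) < \<epsilon>" if "y \<in> {c..d}" "dist y x < \<delta>" for y
    using \<delta>(2)[of x y] \<delta>(2)[of y x] that \<open>x \<in> {c..d}\<close>
    by (cases "x \<le> y") (auto simp: dist_real_def)
  then show "\<exists>\<delta>>0. \<forall>y\<in>{c..d}. dist y x < \<delta> \<longrightarrow> dist (u y) (u x) < \<epsilon>"
    using \<delta>(1) by blast
qed

lemma AC_on_subset: "AC_on S u \<Longrightarrow> T \<subseteq> S \<Longrightarrow> AC_on T u"
  unfolding AC_on_iff by (meson nonoverlapping_mono nonoverlappingD(2) subset_refl subset_trans)

text \<open>
  On intervals shorter than the \<open>\<delta>\<close> that belongs to \<open>\<epsilon> = 1\<close> the variation is at most \<open>1\<close>, and countably many of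
  them cover the open interval.
\<close>

theorem AC_on_differentiable_ae:
  assumes "AC_on {c..d} u"
  shows "negligible {x \<in> {c<..<d}. \<not> u differentiable (at x)}"
proof -
  obtain \<delta> where \<delta>: "\<delta> > 0"
    "\<And>D. nonoverlapping {c..d} D \<Longrightarrow> (\<Sum>(s, t)\<in>D. t - s) < \<delta> \<Longrightarrow> increments u D < 1"
    using assms zero_less_one unfolding AC_on_iff by meson
  define J where "J = {(q, r). q \<in> \<rat> \<and> r \<in> \<rat> \<and> c \<le> q \<and> q < r \<and> r \<le> d \<and> r - q < \<delta>}"
  define N where "N = (\<lambda>(q, r). {x \<in> {q<..<r}. \<not> u differentiable (at x)})"
  have "negligible (N (q, r))" if "(q, r) \<in> J" for q r
    unfolding N_def prod.case
  proof (rule bounded_variation_differentiable_ae)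
    show "bounded_variation q r u"
      unfolding bounded_variation_def bdd_above_def
    proof (intro exI ballI, elim imageE CollectE, clarify)
      fix D assume D: "nonoverlapping {q..r} D"
      have "nonoverlapping {c..d} D"
        using D
      proof (rule nonoverlapping_mono)
        fix s t assume "(s, t) \<in> D"
        from nonoverlapping_IccD[OF D this] show "{s..t} \<subseteq> {c..d}"
          using that by (auto simp: J_def)
      qed simp
      moreover have "(\<Sum>(s, t)\<in>D. t - s) \<le> r - q"
        using that by (intro sum_increments_le[OF D]) (auto intro: mono_onI simp: J_def)
      ultimately show "increments u D \<le> 1"
        using \<delta>(2)[of D] that by (simp add: J_def)
    qed
  qed
  then have "negligible (\<Union> (N ` J))"
    by (intro negligible_countable_Union countable_image
          countable_subset[OF _ countable_SIGMA[OF countable_rat countable_rat]]) (auto simp: J_def)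
  then show ?thesis
  proof (rule negligible_subset, intro subsetI)
    fix x assume "x \<in> {x \<in> {c<..<d}. \<not> u differentiable (at x)}"
    then have x: "c < x" "x < d" "\<not> u differentiable (at x)" by auto
    obtain q where q: "q \<in> \<rat>" "max c (x - \<delta> / 2) < q" "q < x"
      using Rats_dense_in_real[of "max c (x - \<delta> / 2)" x] x \<open>\<delta> > 0\<close> by auto
    obtain r where r: "r \<in> \<rat>" "x < r" "r < min d (x + \<delta> / 2)"
      using Rats_dense_in_real[of x "min d (x + \<delta> / 2)"] x \<open>\<delta> > 0\<close> by auto
    have "(q, r) \<in> J" "x \<in> N (q, r)" using q r x by (auto simp: J_def N_def)
    then show "x \<in> \<Union> (N ` J)" by blast
  qed
qed

text \<open>
  The integral is the Henstock--Kurzweil integral, for which this needs no integrability hypothesis on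
  \<open>g\<close>.  The gauge at a point outside \<open>N\<close> comes from differentiability.  At a point of \<open>N\<close>
  it is an open set of small measure that contains \<open>N\<close>; the increments of \<open>F\<close> over the intervals with tags
  in \<open>N\<close> are then small in total by absolute continuity.
\<close>

theorem AC_on_fundamental_theorem_of_calculus:
  assumes AC: "AC_on {c..d} F" and "c \<le> d" and N: "negligible N"
    and deriv: "\<And>x. x \<in> {c..d} - N \<Longrightarrow> (F has_real_derivative g x) (at x within {c..d})"
  shows "(g has_integral (F d - F c)) {c..d}"
proof -
  define g' where "g' = (\<lambda>x. if x \<in> N then 0 else g x)"
  have "(g' has_integral (F d - F c)) {c..d}"
    unfolding has_integral_real
  proof (intro allI impI)
    fix e :: real assume "e > 0"
    define e1 where "e1 = e / (2 * (d - c + 1))"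
    have "e1 > 0" and e1: "e1 * (d - c) < e / 2"
      using \<open>e > 0\<close> \<open>c \<le> d\<close> by (auto simp: e1_def field_simps)
    have "\<exists>r>0. \<forall>y\<in>{c..d}. \<bar>y - x\<bar> < r \<longrightarrow> \<bar>F y - F x - g x * (y - x)\<bar> \<le> e1 * \<bar>y - x\<bar>"
      if "x \<in> {c..d} - N" for x
      using deriv[OF that] \<open>e1 > 0\<close>
      unfolding has_field_derivative_def has_derivative_within_alt by auto
    then obtain r where r: "\<And>x. x \<in> {c..d} - N \<Longrightarrow> r x > 0"
      "\<And>x y. x \<in> {c..d} - N \<Longrightarrow> y \<in> {c..d} \<Longrightarrow> \<bar>y - x\<bar> < r x
          \<Longrightarrow> \<bar>F y - F x - g x * (y - x)\<bar> \<le> e1 * \<bar>y - x\<bar>"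
      by metis
    obtain \<delta> where \<delta>: "\<delta> > 0"
      "\<And>D. nonoverlapping {c..d} D \<Longrightarrow> (\<Sum>(s, t)\<in>D. t - s) < \<delta> \<Longrightarrow> increments F D < e / 2"
      using AC \<open>e > 0\<close> half_gt_zero unfolding AC_on_iff by meson
    obtain O' where O': "open O'" "N \<subseteq> O'" "O' \<in> lmeasurable" "measure lebesgue O' < \<delta>"
    proof -
      have Ns: "N \<in> null_sets lebesgue" using N by (simp add: negligible_iff_null_sets)
      obtain T where T: "open T" "N \<subseteq> T" "T - N \<in> lmeasurable" "emeasure lebesgue (T - N) < ennreal \<delta>"
        using sets_lebesgue_outer_open[of N \<delta>] Ns \<delta>(1) by blast
      have "T = (T - N) \<union> N" using T(2) by blast
      moreover have "(T - N) \<union> N \<in> lmeasurable"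
        by (intro fmeasurable.Un T(3) fmeasurableI_null_sets Ns)
      moreover have "emeasure lebesgue ((T - N) \<union> N) = emeasure lebesgue (T - N)"
        using T(3) Ns by (intro emeasure_Un_null_set) auto
      ultimately have "T \<in> lmeasurable" "emeasure lebesgue T < ennreal \<delta>"
        using T(4) by simp_all
      then show thesis
        using that[OF T(1,2)] \<delta>(1)
        by (simp add: emeasure_eq_measure2 ennreal_less_iff)
    qed
    define \<gamma> where "\<gamma> = (\<lambda>x. if x \<in> N then O' else if x \<in> {c..d} then ball x (r x) else ball x 1)"
    have gauge: "gauge \<gamma>"
      unfolding gauge_def \<gamma>_def using O' r(1) by auto
    have small: "norm ((\<Sum>(x, K)\<in>p. measure lborel K *\<^sub>R g' x) - (F d - F c)) < e"
      if p: "p tagged_division_of {c..d}" and fine: "\<gamma> fine p" for p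
    proof -
      note pD = tagged_division_ofD[OF p]
      have pK: "x \<in> {c..d} \<and> x \<in> K \<and> (\<exists>s t. K = {s..t} \<and> s \<le> x \<and> x \<le> t \<and> c \<le> s \<and> t \<le> d)"
        if xK: "(x, K) \<in> p" for x K
      proof -
        obtain s t where "K = {s..t}" using pD(4)[OF xK] by auto
        then show ?thesis using pD(2,3)[OF xK] by (auto simp: subset_iff)
      qed
      define \<Delta> where "\<Delta> = (\<lambda>(x, K). if x \<in> N then \<bar>F (Sup K) - F (Inf K)\<bar> else 0 :: real)"
      have bound: "norm (measure lborel K *\<^sub>R g' x - (F (Sup K) - F (Inf K)))
          \<le> e1 * (Sup K - Inf K) + \<Delta> (x, K)" if xK: "(x, K) \<in> p" for x K
      proof -
        obtain s t where K: "K = {s..t}" "s \<le> x" "x \<le> t" "c \<le> s" "t \<le> d"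
          using pK[OF xK] by blast
        show ?thesis
        proof (cases "x \<in> N")
          case True
          have "0 \<le> e1 * (t - s)" using K \<open>e1 > 0\<close> by simp
          with True show ?thesis using K by (simp add: g'_def \<Delta>_def)
        next
          case False
          then have x: "x \<in> {c..d} - N" using K by auto
          have sub: "K \<subseteq> ball x (r x)"
            using fineD[OF fine xK] x by (simp add: \<gamma>_def)
          have "s \<in> K" "t \<in> K" using K by auto
          then have "\<bar>s - x\<bar> < r x" "\<bar>t - x\<bar> < r x"
            using sub by (auto simp: dist_real_def)
          moreover have "s \<in> {c..d}" "t \<in> {c..d}" using K by auto
          ultimately have "\<bar>F s - F x - g x * (s - x)\<bar> \<le> e1 * \<bar>s - x\<bar>"
              "\<bar>F t - F x - g x * (t - x)\<bar> \<le> e1 * \<bar>t - x\<bar>"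
            by (blast intro: r(2)[OF x])+
          moreover have "(t - s) * g x - (F t - F s)
              = (F s - F x - g x * (s - x)) - (F t - F x - g x * (t - x))"
            by (simp add: algebra_simps)
          moreover have "e1 * \<bar>s - x\<bar> + e1 * \<bar>t - x\<bar> = e1 * (t - s)"
            using K by (simp add: algebra_simps)
          ultimately show ?thesis
            using K False by (simp add: g'_def \<Delta>_def)
        qed
      qed
      define q where "q = {(x, K) \<in> p. x \<in> N \<and> Inf K < Sup K}"
      define D where "D = (\<lambda>(x, K). (Inf K, Sup K)) ` q"
      have finp: "finite p" by (rule pD(1))
      have "finite q" unfolding q_def by (rule finite_subset[OF _ finp]) auto
      have qK: "{Inf K..Sup K} = K \<and> c \<le> Inf K \<and> Sup K \<le> d \<and> K \<subseteq> O' \<and> Inf K < Sup K"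
        if "(x, K) \<in> q" for x K
      proof -
        have xK: "(x, K) \<in> p" "x \<in> N" "Inf K < Sup K" using that by (auto simp: q_def)
        obtain s t where K: "K = {s..t}" "s \<le> x" "x \<le> t" "c \<le> s" "t \<le> d"
          using pK[OF xK(1)] by blast
        have "K \<subseteq> O'" using fineD[OF fine xK(1)] xK(2) by (simp add: \<gamma>_def)
        then show ?thesis using K xK(3) by simp
      qed
      have sep: "Sup K \<le> Inf K' \<or> Sup K' \<le> Inf K"
        if "(x, K) \<in> q" "(x', K') \<in> q" "(x, K) \<noteq> (x', K')" for x K x' K'
      proof (rule ccontr)
        assume "\<not> ?thesis"
        then have "(max (Inf K) (Inf K') + min (Sup K) (Sup K')) / 2
            \<in> {Inf K<..<Sup K} \<inter> {Inf K'<..<Sup K'}"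
          using qK[OF that(1)] qK[OF that(2)] by auto
        moreover have "interior {Inf K..Sup K} \<inter> interior {Inf K'..Sup K'} = {}"
          using pD(5)[of x K x' K'] that qK[OF that(1)] qK[OF that(2)] by (auto simp: q_def)
        ultimately show False by auto
      qed
      have inj: "inj_on (\<lambda>(x, K). (Inf K, Sup K)) q"
      proof (rule inj_onI, clarify, rule ccontr)
        fix x K x' K' assume xK: "(x, K) \<in> q" "(x', K') \<in> q"
          and eq: "Inf K = Inf K'" "Sup K = Sup K'" and "\<not> (x = x' \<and> K = K')"
        then have "Sup K \<le> Inf K' \<or> Sup K' \<le> Inf K"
          by (intro sep[OF xK]) simp
        moreover have "Inf K < Sup K" using qK[OF xK(1)] by blast
        ultimately show False using eq by linarith
      qed
      have no: "nonoverlapping S D" if "S = {c..d} \<or> S = O'" for S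
      proof (rule nonoverlappingI)
        show "finite D" unfolding D_def using \<open>finite q\<close> by simp
        show "s < t \<and> {s..t} \<subseteq> S" if stD: "(s, t) \<in> D" for s t
        proof -
          obtain x K where xK: "(x, K) \<in> q" and st: "s = Inf K" "t = Sup K"
            using stD by (auto simp: D_def)
          have "{Inf K..Sup K} \<subseteq> {c..d}"
            unfolding atLeastatMost_subset_iff using qK[OF xK] by blast
          moreover have "{Inf K..Sup K} \<subseteq> O'"
            using qK[OF xK] by argo
          ultimately show ?thesis using qK[OF xK] \<open>S = {c..d} \<or> S = O'\<close> unfolding st by blast
        qed
        show "t \<le> s' \<or> t' \<le> s" if stD: "(s, t) \<in> D" "(s', t') \<in> D" "(s, t) \<noteq> (s', t')" for s t s' t'
        proof -
          obtain x K where xK: "(x, K) \<in> q" and st: "s = Inf K" "t = Sup K"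
            using stD(1) by (auto simp: D_def)
          obtain x' K' where xK': "(x', K') \<in> q" and st': "s' = Inf K'" "t' = Sup K'"
            using stD(2) by (auto simp: D_def)
          show ?thesis unfolding st st'
            by (rule sep[OF xK xK']) (use stD(3) in \<open>auto simp: st st'\<close>)
        qed
      qed
      have "(\<Sum>(s, t)\<in>D. t - s) = (\<Sum>(s, t)\<in>D. measure lebesgue {s<..<t})"
        using nonoverlappingD(1)[OF no[of O']]
        by (intro sum.cong refl) (auto simp: less_imp_le)
      also have "\<dots> = measure lebesgue (\<Union>(s, t)\<in>D. {s<..<t})"
        using no[of O'] unfolding nonoverlapping_def
        by (subst measure_finite_Union) (auto simp: case_prod_unfold)
      also have "\<dots> \<le> measure lebesgue O'"
      proof (rule measure_mono_fmeasurable[OF _ _ O'(3)])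
        show "(\<Union>(s, t)\<in>D. {s<..<t}) \<subseteq> O'"
        proof clarify
          fix x s t assume "(s, t) \<in> D" "x \<in> {s<..<t}"
          then show "x \<in> O'" using nonoverlappingD(2)[OF no[of O'], of s t] by auto
        qed
        have "open (\<Union>(s, t)\<in>D. {s<..<t})" by (rule open_UN) (simp add: case_prod_unfold)
        then have "(\<Union>(s, t)\<in>D. {s<..<t}) \<in> sets lborel" by (simp only: borel_open sets_lborel)
        then show "(\<Union>(s, t)\<in>D. {s<..<t}) \<in> sets lebesgue" by (rule sets_completionI_sets)
      qed
      finally have "increments F D < e / 2" using \<delta>(2)[of D] no O'(4) by simp
      moreover have "increments F D = (\<Sum>(x, K)\<in>q. \<bar>F (Sup K) - F (Inf K)\<bar>)"
        unfolding increments_def D_def by (subst sum.reindex[OF inj]) (simp add: o_def case_prod_unfold)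
      moreover have "(\<Sum>(x, K)\<in>q. \<bar>F (Sup K) - F (Inf K)\<bar>) = sum \<Delta> p"
      proof (rule sum.mono_neutral_cong_left[OF finp])
        show "\<forall>i\<in>p - q. \<Delta> i = 0"
        proof clarify
          fix x K assume xK: "(x, K) \<in> p" "(x, K) \<notin> q"
          obtain s t where K: "K = {s..t}" "s \<le> x" "x \<le> t" using pK[OF xK(1)] by blast
          then have "x \<in> N \<Longrightarrow> s = t" using xK by (simp add: q_def)
          then show "\<Delta> (x, K) = 0" using K by (auto simp: \<Delta>_def)
        qed
      qed (auto simp: q_def \<Delta>_def)
      moreover have "norm ((\<Sum>(x, K)\<in>p. measure lborel K *\<^sub>R g' x) - (F d - F c))
          \<le> (\<Sum>(x, K)\<in>p. e1 * (Sup K - Inf K) + \<Delta> (x, K))"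
      proof -
        have "(\<Sum>(x, K)\<in>p. measure lborel K *\<^sub>R g' x) - (F d - F c)
            = (\<Sum>(x, K)\<in>p. measure lborel K *\<^sub>R g' x - (F (Sup K) - F (Inf K)))"
          using additive_tagged_division_1[OF \<open>c \<le> d\<close> p, of F]
          by (simp add: case_prod_unfold sum_subtractf)
        also have "norm \<dots> \<le> (\<Sum>(x, K)\<in>p. e1 * (Sup K - Inf K) + \<Delta> (x, K))"
          by (rule sum_norm_le) (use bound in auto)
        finally show ?thesis .
      qed
      moreover have "(\<Sum>(x, K)\<in>p. e1 * (Sup K - Inf K) + \<Delta> (x, K)) = e1 * (d - c) + sum \<Delta> p"
        using additive_tagged_division_1[OF \<open>c \<le> d\<close> p, of "\<lambda>x. x"]
        by (simp add: case_prod_unfold sum.distrib flip: sum_distrib_left)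
      ultimately show ?thesis using e1 by linarith
    qed
    show "\<exists>\<gamma>. gauge \<gamma> \<and> (\<forall>\<D>. \<D> tagged_division_of {c..d} \<and> \<gamma> fine \<D> \<longrightarrow>
        norm ((\<Sum>(x, K)\<in>\<D>. measure lborel K *\<^sub>R g' x) - (F d - F c)) < e)"
      by (intro exI[of _ \<gamma>] conjI allI impI gauge small) simp_all
  qed
  then show ?thesis
    by (rule has_integral_spike[OF N, rotated]) (simp add: g'_def)
qed

lemma AC_on_dominated:
  assumes "AC_on S u" "AC_on S v" "A \<ge> 0" "B \<ge> 0"
    and dom: "\<And>s t. s < t \<Longrightarrow> {s..t} \<subseteq> S \<Longrightarrow> \<bar>w t - w s\<bar> \<le> A * \<bar>u t - u s\<bar> + B * \<bar>v t - v s\<bar>"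
  shows "AC_on S w"
  unfolding AC_on_iff
proof (intro allI impI)
  fix \<epsilon> :: real assume "\<epsilon> > 0"
  define \<eta> where "\<eta> = \<epsilon> / (A + B + 1)"
  have "\<eta> > 0" using \<open>\<epsilon> > 0\<close> assms(3,4) by (simp add: \<eta>_def)
  obtain \<delta>1 where \<delta>1: "\<delta>1 > 0"
    "\<And>D. nonoverlapping S D \<Longrightarrow> (\<Sum>(s, t)\<in>D. t - s) < \<delta>1 \<Longrightarrow> increments u D < \<eta>"
    using assms(1) \<open>\<eta> > 0\<close> unfolding AC_on_iff by meson
  obtain \<delta>2 where \<delta>2: "\<delta>2 > 0"
    "\<And>D. nonoverlapping S D \<Longrightarrow> (\<Sum>(s, t)\<in>D. t - s) < \<delta>2 \<Longrightarrow> increments v D < \<eta>"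
    using assms(2) \<open>\<eta> > 0\<close> unfolding AC_on_iff by meson
  have "increments w D < \<epsilon>" if D: "nonoverlapping S D" "(\<Sum>(s, t)\<in>D. t - s) < min \<delta>1 \<delta>2" for D
  proof -
    have "increments w D \<le> (\<Sum>(s, t)\<in>D. A * \<bar>u t - u s\<bar> + B * \<bar>v t - v s\<bar>)"
      unfolding increments_def
    proof (rule sum_mono, clarify)
      fix s t assume "(s, t) \<in> D"
      then show "\<bar>w t - w s\<bar> \<le> A * \<bar>u t - u s\<bar> + B * \<bar>v t - v s\<bar>"
        by (intro dom nonoverlappingD[OF D(1)])
    qed
    also have "\<dots> = A * increments u D + B * increments v D"
      by (simp add: increments_def case_prod_unfold sum.distrib sum_distrib_left)
    also have "\<dots> \<le> A * \<eta> + B * \<eta>"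
      using \<delta>1(2)[OF D(1)] \<delta>2(2)[OF D(1)] D(2) assms(3,4)
      by (intro add_mono mult_left_mono) auto
    also have "\<dots> < \<epsilon>"
      using \<open>\<epsilon> > 0\<close> assms(3,4) by (simp add: \<eta>_def divide_simps) (simp add: algebra_simps)
    finally show ?thesis .
  qed
  then show "\<exists>\<delta>>0. \<forall>D. nonoverlapping S D \<and> (\<Sum>(s, t)\<in>D. t - s) < \<delta> \<longrightarrow> increments w D < \<epsilon>"
    using \<delta>1(1) \<delta>2(1) by (intro exI[of _ "min \<delta>1 \<delta>2"]) auto
qed

lemma AC_on_ident: "AC_on S (\<lambda>x. x)"
  unfolding AC_on_iff
proof (intro allI impI)
  fix \<epsilon> :: real assume "\<epsilon> > 0"
  have "increments (\<lambda>x. x) D = (\<Sum>(s, t)\<in>D. t - s)" if "nonoverlapping S D" for D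
    unfolding increments_def by (rule sum.cong[OF refl]) (use nonoverlappingD(1)[OF that] in fastforce)
  then show "\<exists>\<delta>>0. \<forall>D. nonoverlapping S D \<and> (\<Sum>(s, t)\<in>D. t - s) < \<delta> \<longrightarrow> increments (\<lambda>x. x) D < \<epsilon>"
    using \<open>\<epsilon> > 0\<close> by auto
qed

lemma deriv_bounded_imp_lipschitz:
  fixes \<phi> :: "real \<Rightarrow> real"
  assumes "\<And>x. x \<in> {c..d} \<Longrightarrow> (\<phi> has_real_derivative \<phi>' x) (at x)" "\<And>x. x \<in> {c..d} \<Longrightarrow> \<bar>\<phi>' x\<bar> \<le> L"
    and "x \<in> {c..d}" "y \<in> {c..d}"
  shows "\<bar>\<phi> y - \<phi> x\<bar> \<le> L * \<bar>y - x\<bar>"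
  using field_differentiable_bound[of "{c..d}" \<phi> \<phi>' L y x] assms
  by (auto intro: has_field_derivative_at_within)

lemma AC_on_bounded_deriv:
  assumes "\<And>x. x \<in> {c..d} \<Longrightarrow> (w has_real_derivative w' x) (at x)" "\<And>x. x \<in> {c..d} \<Longrightarrow> \<bar>w' x\<bar> \<le> L"
  shows "AC_on {c..d} w"
proof (rule AC_on_dominated[OF AC_on_ident AC_on_ident, of "max 0 L" 0])
  fix s t :: real assume st: "s < t" "{s..t} \<subseteq> {c..d}"
  then have "\<bar>w t - w s\<bar> \<le> L * \<bar>t - s\<bar>"
    by (intro deriv_bounded_imp_lipschitz[OF assms]) auto
  also have "\<dots> \<le> max 0 L * \<bar>t - s\<bar> + 0 * \<bar>t - s\<bar>" by (simp add: mult_right_mono)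
  finally show "\<bar>w t - w s\<bar> \<le> max 0 L * \<bar>t - s\<bar> + 0 * \<bar>t - s\<bar>" .
qed auto

lemma continuous_on_Icc_bounded:
  fixes u :: "real \<Rightarrow> real"
  assumes "continuous_on {c..d} u"
  obtains M where "M \<ge> 0" "\<forall>x\<in>{c..d}. \<bar>u x\<bar> \<le> M"
proof -
  have "bounded (u ` {c..d})"
    by (intro compact_imp_bounded compact_continuous_image assms) simp
  then obtain M where "M > 0" "\<forall>x\<in>u ` {c..d}. norm x \<le> M"
    unfolding bounded_pos by blast
  then show thesis by (intro that[of M]) simp_all
qed

lemma AC_on_compose:
  assumes AC: "AC_on {c..d} u"
    and "\<And>y. (\<phi> has_real_derivative \<phi>' y) (at y)" "continuous_on UNIV \<phi>'"
  shows "AC_on {c..d} (\<lambda>x. \<phi> (u x))"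
proof -
  obtain M where "M \<ge> 0" and M: "\<forall>x\<in>{c..d}. \<bar>u x\<bar> \<le> M"
    by (rule continuous_on_Icc_bounded[OF AC_on_imp_continuous_on[OF AC]])
  have "continuous_on {- M..M} \<phi>'" using assms(3) by (rule continuous_on_subset) simp
  then obtain L where "L \<ge> 0" and L: "\<forall>y\<in>{- M..M}. \<bar>\<phi>' y\<bar> \<le> L"
    by (rule continuous_on_Icc_bounded)
  show ?thesis
  proof (rule AC_on_dominated[OF AC AC, of "max 0 L" 0])
    fix s t assume st: "s < t" "{s..t} \<subseteq> {c..d}"
    then have "\<bar>u s\<bar> \<le> M" "\<bar>u t\<bar> \<le> M" using M by auto
    then have "\<bar>\<phi> (u t) - \<phi> (u s)\<bar> \<le> L * \<bar>u t - u s\<bar>"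
      using L by (intro deriv_bounded_imp_lipschitz[OF assms(2), of "- M" M]) (simp_all add: abs_le_iff)
    also have "\<dots> \<le> max 0 L * \<bar>u t - u s\<bar> + 0 * \<bar>u t - u s\<bar>" by (simp add: mult_right_mono)
    finally show "\<bar>\<phi> (u t) - \<phi> (u s)\<bar> \<le> max 0 L * \<bar>u t - u s\<bar> + 0 * \<bar>u t - u s\<bar>" .
  qed auto
qed

lemma AC_on_mult:
  assumes "AC_on {c..d} u" "AC_on {c..d} v"
  shows "AC_on {c..d} (\<lambda>x. u x * v x)"
proof -
  obtain M where M: "M \<ge> 0" "\<forall>x\<in>{c..d}. \<bar>u x\<bar> \<le> M"
    by (rule continuous_on_Icc_bounded[OF AC_on_imp_continuous_on[OF assms(1)]])
  obtain M' where M': "M' \<ge> 0" "\<forall>x\<in>{c..d}. \<bar>v x\<bar> \<le> M'"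
    by (rule continuous_on_Icc_bounded[OF AC_on_imp_continuous_on[OF assms(2)]])
  show ?thesis
  proof (rule AC_on_dominated[OF assms M'(1) M(1)])
    fix s t assume st: "s < t" "{s..t} \<subseteq> {c..d}"
    have "\<bar>u t * v t - u s * v s\<bar> = \<bar>v t * (u t - u s) + u s * (v t - v s)\<bar>" by (simp add: algebra_simps)
    also have "\<dots> \<le> \<bar>v t\<bar> * \<bar>u t - u s\<bar> + \<bar>u s\<bar> * \<bar>v t - v s\<bar>"
      by (rule order_trans[OF abs_triangle_ineq]) (simp add: abs_mult)
    also have "\<dots> \<le> M' * \<bar>u t - u s\<bar> + M * \<bar>v t - v s\<bar>"
      using M(2) M'(2) st by (intro add_mono mult_right_mono) auto
    finally show "\<bar>u t * v t - u s * v s\<bar> \<le> M' * \<bar>u t - u s\<bar> + M * \<bar>v t - v s\<bar>" .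
  qed
qed

text \<open>
  A locally absolutely continuous primitive of a continuous function is differentiable
  at every point, not only almost everywhere.
\<close>

lemma AC_primitive_on_has_derivative:
  assumes H: "AC_primitive_on {0<..} h H" and h: "continuous_on {0<..} h" and "l > 0"
  shows "(H has_real_derivative h l) (at l)"
proof -
  define c where "c = l / 2"
  define d where "d = l + 1"
  have cd: "0 < c" "c < l" "l < d" using \<open>l > 0\<close> by (auto simp: c_def d_def)
  have AC: "AC_on {c..d} H"
  proof -
    have "c \<le> d \<and> {c..d} \<subseteq> {0<..}" using cd by auto
    moreover have "locally_AC_on {0<..} H" using H by (simp add: AC_primitive_on_def)
    ultimately show ?thesis by (simp add: locally_AC_on_def)
  qed
  obtain N where N: "N \<in> null_sets lebesgue" "{x. \<not> (x \<in> {0<..} \<longrightarrow> (H has_real_derivative h x) (at x))} \<subseteq> N"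
    using H unfolding AC_primitive_on_def eventually_ae_filter by auto
  have *: "integral {c..x} h = H x - H c" if "x \<in> {c..d}" for x
  proof (rule integral_unique, rule AC_on_fundamental_theorem_of_calculus)
    show "AC_on {c..x} H" using AC by (rule AC_on_subset) (use that in auto)
    show "negligible N" using N(1) by (simp add: negligible_iff_null_sets)
    fix y assume y: "y \<in> {c..x} - N"
    then have "y \<notin> {x. \<not> (x \<in> {0<..} \<longrightarrow> (H has_real_derivative h x) (at x))}" using N(2) by blast
    then have "(H has_real_derivative h y) (at y)" using y cd by simp
    then show "(H has_real_derivative h y) (at y within {c..x})"
      by (rule has_field_derivative_at_within)
  qed (use that in auto)
  have "continuous_on {c..d} h" by (rule continuous_on_subset[OF h]) (use cd in auto)
  then have "((\<lambda>x. integral {c..x} h) has_real_derivative h l) (at l within {c..d})"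
    by (rule integral_has_real_derivative) (use cd in auto)
  then have "((\<lambda>x. H x - H c) has_real_derivative h l) (at l within {c..d})"
    by (rule has_field_derivative_transform_within[OF _ zero_less_one]) (use cd * in auto)
  moreover have "at l within {c..d} = at l" using cd by (intro at_within_interior) simp
  ultimately have "((\<lambda>x. H x - H c) has_real_derivative h l) (at l)" by simp
  from DERIV_add[OF this DERIV_const[of "H c"]] show ?thesis by simp
qed

section \<open>Powers and Young's inequality\<close>

text \<open>
  The positive part of \<open>t\<close> raised to the power \<open>q\<close>, continuously differentiable for \<open>q > 1\<close>.
\<close>

definition ramp :: "real \<Rightarrow> real \<Rightarrow> real" where
  "ramp q t = max 0 t powr q"

lemma ramp_has_derivative:
  assumes "q > 1"
  shows "(ramp q has_real_derivative q * ramp (q - 1) t) (at t)"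
proof -
  consider "t > 0" | "t < 0" | "t = 0" by linarith
  then show ?thesis
  proof cases
    case 1
    have "((\<lambda>t. t powr q) has_real_derivative q * t powr (q - 1)) (at t)"
      using 1 by (rule has_real_derivative_powr)
    then have "(ramp q has_real_derivative q * t powr (q - 1)) (at t)"
      by (rule has_field_derivative_transform_within_open[of _ _ _ "{0<..}"])
        (use 1 in \<open>auto simp: ramp_def\<close>)
    then show ?thesis using 1 by (simp add: ramp_def)
  next
    case 2
    have "((\<lambda>t. 0) has_real_derivative 0) (at t)" by simp
    then have "(ramp q has_real_derivative 0) (at t)"
      by (rule has_field_derivative_transform_within_open[of _ _ _ "{..<0}"])
        (use 2 in \<open>auto simp: ramp_def\<close>)
    then show ?thesis using 2 by (simp add: ramp_def)
  next
    case 3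
    have "((\<lambda>y. \<bar>y\<bar> powr (q - 1)) \<longlongrightarrow> \<bar>0\<bar> powr (q - 1)) (at (0::real))"
      using assms by (intro tendsto_intros) auto
    then have "((\<lambda>y. \<bar>y\<bar> powr (q - 1)) \<longlongrightarrow> 0) (at (0::real))" by simp
    then have "((\<lambda>y. (ramp q y - ramp q 0) / (y - 0)) \<longlongrightarrow> 0) (at 0)"
    proof (rule Lim_null_comparison[rotated], intro always_eventually allI)
      fix y :: real
      have "\<bar>ramp q y\<bar> \<le> \<bar>y\<bar> powr (q - 1) * \<bar>y\<bar>"
      proof (cases "y > 0")
        case True
        then have "y powr q = y powr (q - 1) * y"
          by (simp add: powr_diff)
        then show ?thesis using True by (simp add: ramp_def)
      next
        case False
        then have "ramp q y = 0" by (simp add: ramp_def max_def)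
        moreover have "0 \<le> \<bar>y\<bar> powr (q - 1) * \<bar>y\<bar>" by (intro mult_nonneg_nonneg) simp_all
        ultimately show ?thesis by (simp only: abs_zero)
      qed
      then show "norm ((ramp q y - ramp q 0) / (y - 0)) \<le> \<bar>y\<bar> powr (q - 1)"
        by (cases "y = 0") (auto simp: ramp_def divide_simps)
    qed
    then have "(ramp q has_real_derivative 0) (at 0)"
      by (simp add: has_field_derivative_iff)
    then show ?thesis using 3 by (simp add: ramp_def)
  qed
qed

lemma continuous_on_ramp [continuous_intros]:
  assumes "q > 0" "continuous_on S g"
  shows "continuous_on S (\<lambda>x. ramp q (g x))"
  unfolding ramp_def using assms by (intro continuous_on_powr' continuous_intros) auto

text \<open>
  The map \<open>y \<mapsto> \<bar>y\<bar> powr (p - 2) * y\<close> and its derivative.  The case distinction in the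
  derivative is needed because \<open>0 powr 0 = 0\<close>.
\<close>

definition phi :: "real \<Rightarrow> real \<Rightarrow> real" where
  "phi p y = \<bar>y\<bar> powr (p - 2) * y"

definition phi' :: "real \<Rightarrow> real \<Rightarrow> real" where
  "phi' p y = (if p = 2 then 1 else (p - 1) * \<bar>y\<bar> powr (p - 2))"

lemma phi_mult_self:
  assumes "p \<ge> 2"
  shows "phi p y * y = \<bar>y\<bar> powr p"
proof (cases "y = 0")
  case False
  have "\<bar>y\<bar> powr p = \<bar>y\<bar> powr (p - 2) * \<bar>y\<bar> powr 2"
    using powr_add[of "\<bar>y\<bar>" "p - 2" 2] by simp
  also have "\<bar>y\<bar> powr 2 = y * y" using False by (simp add: power2_eq_square)
  finally show ?thesis by (simp add: phi_def)
qed (simp add: phi_def)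

lemma phi_eq_ramp:
  assumes "p \<ge> 2"
  shows "phi p y = ramp (p - 1) y - ramp (p - 1) (- y)"
proof -
  have "\<bar>y\<bar> powr (p - 1) = \<bar>y\<bar> powr (p - 2) * \<bar>y\<bar>" if "y \<noteq> 0"
    using that powr_add[of "\<bar>y\<bar>" "p - 2" 1] by simp
  then show ?thesis
    by (cases y "0 :: real" rule: linorder_cases) (auto simp: phi_def ramp_def)
qed

lemma phi_has_derivative:
  assumes "p \<ge> 2"
  shows "(phi p has_real_derivative phi' p y) (at y)"
proof (cases "p = 2")
  case True
  then have "phi p = (\<lambda>y. y)" by (auto simp: phi_def fun_eq_iff)
  then show ?thesis using True by (simp add: phi'_def)
next
  case False
  then have "p - 1 > 1" using assms by simp
  note R = ramp_has_derivative[OF this]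
  have "((\<lambda>y. ramp (p - 1) y - ramp (p - 1) (- y)) has_real_derivative
      (p - 1) * ramp (p - 1 - 1) y - (p - 1) * ramp (p - 1 - 1) (- y) * (- 1)) (at y)"
    by (intro DERIV_diff R DERIV_chain2[OF R]) (auto intro!: derivative_eq_intros)
  moreover have "(p - 1) * ramp (p - 1 - 1) y - (p - 1) * ramp (p - 1 - 1) (- y) * (- 1) = phi' p y"
    using False by (cases y "0 :: real" rule: linorder_cases) (auto simp: ramp_def phi'_def)
  moreover have "(\<lambda>y. ramp (p - 1) y - ramp (p - 1) (- y)) = phi p"
    using phi_eq_ramp[OF assms] by auto
  ultimately show ?thesis by simp
qed

lemma continuous_on_phi':
  assumes "p \<ge> 2"
  shows "continuous_on S (phi' p)"
proof (cases "p = 2")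
  case False
  then show ?thesis unfolding phi'_def using assms
    by (simp, intro continuous_on_mult continuous_on_powr' continuous_intros) auto
qed (simp add: phi'_def)

lemma young_powr:
  fixes x w q :: real
  assumes "q \<ge> 1" "x \<ge> 0" "w \<ge> 0"
  shows "w * x powr (q - 1) \<le> (1 - 1 / q) * x powr q + 1 / q * w powr q"
proof (cases "x = 0 \<or> w = 0")
  case True
  then show ?thesis using assms by (auto simp: mult_nonneg_nonneg)
next
  case False
  then have "x > 0" "w > 0" using assms by auto
  then have "(x powr q) powr (1 - 1 / q) * (w powr q) powr (1 / q)
      \<le> (1 - 1 / q) * x powr q + 1 / q * w powr q"
    using assms by (intro Youngs_inequality_0) auto
  moreover have "(x powr q) powr (1 - 1 / q) = x powr (q - 1)"
    using assms by (simp add: powr_powr algebra_simps)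
  moreover have "(w powr q) powr (1 / q) = w"
    using assms \<open>w > 0\<close> by (simp add: powr_powr)
  ultimately show ?thesis by (simp add: mult.commute)
qed

text \<open>
  A version with an arbitrarily small first coefficient, for an error term where the size of the second
  coefficient does not matter.
\<close>

lemma young_powr_small:
  fixes x w q \<tau> :: real
  assumes "q \<ge> 1" "x \<ge> 0" "w \<ge> 0" "\<tau> > 0"
  shows "w * x powr (q - 1) \<le> \<tau> * x powr q + \<tau> powr (1 - q) * w powr q"
proof (cases "w \<le> \<tau> * x")
  case True
  have "w * x powr (q - 1) \<le> \<tau> * x * x powr (q - 1)"
    using True by (rule mult_right_mono) simp
  also have "\<dots> = \<tau> * x powr q"
    using assms(2) by (cases "x = 0") (simp_all add: powr_diff)
  also have "\<dots> \<le> \<tau> * x powr q + \<tau> powr (1 - q) * w powr q" by simp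
  finally show ?thesis .
next
  case False
  then have "w > 0" using assms by (smt (verit) mult_nonneg_nonneg)
  have "x \<le> w / \<tau>" using False assms by (simp add: field_simps)
  then have "w * x powr (q - 1) \<le> w * (w / \<tau>) powr (q - 1)"
    using assms by (intro mult_left_mono powr_mono2) auto
  also have "\<dots> = \<tau> powr (1 - q) * w powr q"
  proof -
    have "(w / \<tau>) powr (q - 1) = w powr (q - 1) * \<tau> powr (1 - q)"
      using assms powr_minus[of \<tau> "q - 1"] by (simp add: powr_divide) (simp add: divide_inverse)
    moreover have "w powr q = w * w powr (q - 1)" using \<open>w > 0\<close> by (simp add: powr_diff)
    ultimately show ?thesis by simp
  qed
  also have "\<dots> \<le> \<tau> * x powr q + \<tau> powr (1 - q) * w powr q" using assms by simp
  finally show ?thesis .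
qed

lemma phi'_young:
  fixes y w :: real
  assumes "p \<ge> 2" "w \<ge> 0"
  shows "phi' p y * w \<le> (1 - 2 / p) * \<bar>y\<bar> powr p + 2 / p * ((p - 1) powr (p / 2) * w powr (p / 2))"
proof (cases "p = 2")
  case True
  then show ?thesis using assms by (simp add: phi'_def)
next
  case False
  have "((p - 1) * w) * (\<bar>y\<bar> powr 2) powr (p / 2 - 1)
      \<le> (1 - 1 / (p / 2)) * (\<bar>y\<bar> powr 2) powr (p / 2) + 1 / (p / 2) * ((p - 1) * w) powr (p / 2)"
    using assms by (intro young_powr) auto
  moreover have "2 * (p / 2 - 1) = p - 2" by (simp add: algebra_simps)
  ultimately show ?thesis using False assms
    by (simp only: phi'_def powr_powr powr_mult if_False) (simp add: mult_ac)
qed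

section \<open>The cut-off primitive and the pointwise estimate\<close>

text \<open>
  The data of the inequality, with \<open>H\<close> an everywhere differentiable primitive of \<open>h\<close>.
\<close>

locale weight =
  fixes p :: real and h H :: "real \<Rightarrow> real"
  assumes p: "p \<ge> 2"
    and h_cont: "continuous_on {0<..} h"
    and h_pos: "\<And>l. l > 0 \<Longrightarrow> h l > 0"
    and H_deriv: "\<And>l. l > 0 \<Longrightarrow> (H has_real_derivative h l) (at l)"
begin

text \<open>
  For \<open>l > \<delta>\<close> the cut-off factor is \<open>(1 - \<delta> / l) powr p\<close>, and it vanishes for \<open>l \<le> \<delta>\<close>; the maximum
  in the denominators makes the formulas continuous on the whole line.  The exponent \<open>p\<close> is large enough for
  \<open>cutoff'\<close> to be controlled by the factor itself in lemma \<open>H_cutoff'_le\<close>.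
\<close>

definition cutoff :: "real \<Rightarrow> real \<Rightarrow> real" where
  "cutoff \<delta> l = ramp p (1 - \<delta> / max \<delta> l)"

definition cutoff' :: "real \<Rightarrow> real \<Rightarrow> real" where
  "cutoff' \<delta> l = p * ramp (p - 1) (1 - \<delta> / max \<delta> l) * (\<delta> / (max \<delta> l)\<^sup>2)"

text \<open>
  The odd extension of \<open>H\<close>, cut off near \<open>0\<close>.  Its derivative \<open>Psi'\<close> is the sum of the cut-off \<open>h_cut\<close>
  of the even extension of \<open>h\<close> and an error that contains \<open>cutoff'\<close>.  Replacing \<open>\<bar>s\<bar>\<close> by
  \<open>max \<delta> \<bar>s\<bar>\<close> in the arguments of \<open>h\<close> and \<open>H\<close> changes nothing, since the other factor
  vanishes for \<open>\<bar>s\<bar> \<le> \<delta>\<close>, and keeps the arguments positive.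
\<close>

definition Psi :: "real \<Rightarrow> real \<Rightarrow> real" where
  "Psi \<delta> s = sgn s * H \<bar>s\<bar> * cutoff \<delta> \<bar>s\<bar>"

definition h_cut :: "real \<Rightarrow> real \<Rightarrow> real" where
  "h_cut \<delta> s = h (max \<delta> \<bar>s\<bar>) * cutoff \<delta> \<bar>s\<bar>"

definition Psi' :: "real \<Rightarrow> real \<Rightarrow> real" where
  "Psi' \<delta> s = h_cut \<delta> s + H (max \<delta> \<bar>s\<bar>) * cutoff' \<delta> \<bar>s\<bar>"

lemma cutoff_eq_0: "\<delta> > 0 \<Longrightarrow> l \<le> \<delta> \<Longrightarrow> cutoff \<delta> l = 0"
  by (simp add: cutoff_def ramp_def max_def)

lemma cutoff'_eq_0: "\<delta> > 0 \<Longrightarrow> l \<le> \<delta> \<Longrightarrow> cutoff' \<delta> l = 0"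
  by (simp add: cutoff'_def ramp_def max_def)

lemma cutoff_eq: "\<delta> > 0 \<Longrightarrow> l > \<delta> \<Longrightarrow> cutoff \<delta> l = (1 - \<delta> / l) powr p"
  by (simp add: cutoff_def ramp_def max_def)

lemma cutoff'_eq: "\<delta> > 0 \<Longrightarrow> l > \<delta> \<Longrightarrow> cutoff' \<delta> l = p * (1 - \<delta> / l) powr (p - 1) * (\<delta> / l\<^sup>2)"
  by (simp add: cutoff'_def ramp_def max_def)

lemma cutoff_nonneg: "0 \<le> cutoff \<delta> l"
  by (simp add: cutoff_def ramp_def)

lemma h_cut_nonneg: "\<delta> > 0 \<Longrightarrow> 0 \<le> h_cut \<delta> s"
  unfolding h_cut_def using h_pos[of "max \<delta> \<bar>s\<bar>"]
  by (intro mult_nonneg_nonneg cutoff_nonneg) (simp add: less_imp_le less_max_iff_disj)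

lemma cutoff_has_derivative:
  assumes "\<delta> > 0" "l > 0"
  shows "(cutoff \<delta> has_real_derivative cutoff' \<delta> l) (at l)"
proof -
  have ramp_eq: "ramp q (1 - \<delta> / l) = ramp q (1 - \<delta> / max \<delta> l)" if "l > 0" for q l
    using that assms(1) by (auto simp: ramp_def max_def field_simps)
  have inner: "((\<lambda>l. 1 - \<delta> / l) has_real_derivative \<delta> / l\<^sup>2) (at l)"
    using assms by (auto intro!: derivative_eq_intros simp: power2_eq_square)
  have "((\<lambda>l. ramp p (1 - \<delta> / l)) has_real_derivative p * ramp (p - 1) (1 - \<delta> / l) * (\<delta> / l\<^sup>2)) (at l)"
    by (rule DERIV_chain2[OF ramp_has_derivative inner]) (use p in simp)
  then have "(cutoff \<delta> has_real_derivative p * ramp (p - 1) (1 - \<delta> / l) * (\<delta> / l\<^sup>2)) (at l)"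
    by (rule has_field_derivative_transform_within_open[of _ _ _ "{0<..}"])
      (use assms in \<open>auto simp: cutoff_def ramp_eq[symmetric]\<close>)
  moreover have "p * ramp (p - 1) (1 - \<delta> / l) * (\<delta> / l\<^sup>2) = cutoff' \<delta> l"
    using assms p unfolding cutoff'_def ramp_eq[OF assms(2)]
    by (cases "l \<le> \<delta>") (simp_all add: ramp_def max_def)
  ultimately show ?thesis by simp
qed

lemma Psi_has_derivative:
  assumes "\<delta> > 0"
  shows "(Psi \<delta> has_real_derivative Psi' \<delta> s) (at s)"
proof -
  have HC: "((\<lambda>l. H l * cutoff \<delta> l) has_real_derivative Psi' \<delta> l) (at l)" if "l > 0" for l
  proof -
    have "((\<lambda>l. H l * cutoff \<delta> l) has_real_derivative H l * cutoff' \<delta> l + h l * cutoff \<delta> l) (at l)"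
      by (intro DERIV_mult' H_deriv cutoff_has_derivative assms that)
    moreover have "H l * cutoff' \<delta> l + h l * cutoff \<delta> l = Psi' \<delta> l"
      using that cutoff_eq_0[OF assms, of l] cutoff'_eq_0[OF assms, of l]
      by (cases "l \<le> \<delta>") (auto simp: Psi'_def h_cut_def max_def)
    ultimately show ?thesis by simp
  qed
  consider "s > 0" | "s < 0" | "s = 0" by linarith
  then show ?thesis
  proof cases
    case 1
    show ?thesis
      by (rule has_field_derivative_transform_within_open[OF HC[OF 1], of "{0<..}"])
        (use 1 in \<open>auto simp: Psi_def\<close>)
  next
    case 2
    have "((\<lambda>s. - (H (- s) * cutoff \<delta> (- s))) has_real_derivative - (Psi' \<delta> (- s) * - 1)) (at s)"
      by (intro DERIV_minus DERIV_chain2[OF HC]) (use 2 in \<open>auto intro!: derivative_eq_intros\<close>)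
    then have "(Psi \<delta> has_real_derivative - (Psi' \<delta> (- s) * - 1)) (at s)"
      by (rule has_field_derivative_transform_within_open[of _ _ _ "{..<0}"])
        (use 2 in \<open>auto simp: Psi_def\<close>)
    moreover have "- (Psi' \<delta> (- s) * - 1) = Psi' \<delta> s" by (simp add: Psi'_def h_cut_def)
    ultimately show ?thesis by simp
  next
    case 3
    have "((\<lambda>s. 0) has_real_derivative 0) (at s)" by simp
    then have "(Psi \<delta> has_real_derivative 0) (at s)"
      by (rule has_field_derivative_transform_within_open[of _ _ _ "{-\<delta><..<\<delta>}"])
        (use 3 assms in \<open>auto simp: Psi_def cutoff_eq_0\<close>)
    moreover have "Psi' \<delta> s = 0"
      using 3 assms by (simp add: Psi'_def h_cut_def cutoff_eq_0 cutoff'_eq_0)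
    ultimately show ?thesis by simp
  qed
qed

lemma continuous_on_H: "continuous_on {0<..} H"
  by (rule DERIV_continuous_on) (auto intro: has_field_derivative_at_within H_deriv)

lemma continuous_on_cutoff: "\<delta> > 0 \<Longrightarrow> continuous_on S (\<lambda>s. cutoff \<delta> \<bar>s\<bar>)"
  unfolding cutoff_def using p
  by (intro continuous_on_ramp continuous_intros) auto

lemma continuous_on_cutoff': "\<delta> > 0 \<Longrightarrow> continuous_on S (\<lambda>s. cutoff' \<delta> \<bar>s\<bar>)"
  unfolding cutoff'_def using p
  by (intro continuous_on_ramp continuous_intros) auto

lemma continuous_on_h_cut: "\<delta> > 0 \<Longrightarrow> continuous_on S (h_cut \<delta>)"
  unfolding h_cut_def
  by (intro continuous_on_mult continuous_on_cutoff continuous_on_compose2[OF h_cont] continuous_intros) auto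

lemma continuous_on_Psi': "\<delta> > 0 \<Longrightarrow> continuous_on S (Psi' \<delta>)"
  unfolding Psi'_def
  by (intro continuous_on_add continuous_on_mult continuous_on_h_cut continuous_on_cutoff'
        continuous_on_compose2[OF continuous_on_H] continuous_intros) auto

text \<open>
  The transform \<open>H / h\<close> and the weight of the integrability condition, for the fixed data.
\<close>

definition T :: "real \<Rightarrow> real" where "T = T_trans h H"

definition G :: "real \<Rightarrow> real" where "G = G_fun p h H"

lemma G_nonneg: "l > 0 \<Longrightarrow> 0 \<le> G l"
  using h_pos[of l] by (simp add: G_def G_fun_def)

lemma H_eq: "l > 0 \<Longrightarrow> H l = h l * T l"
  using h_pos[of l] by (simp add: T_def T_trans_def)

text \<open>
  The error of cutting off is absorbed by a small multiple of the cut-off weight plus a multiple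
  of \<open>G\<close>.  The factor \<open>\<delta> / l\<close>, which tends to \<open>0\<close> with \<open>\<delta>\<close>, makes the second term
  disappear in the limit.
\<close>

lemma H_cutoff'_le:
  assumes "0 < \<delta>" "\<delta> < l" "\<tau> > 0"
  shows "\<bar>H l\<bar> * cutoff' \<delta> l \<le> \<tau> * (h l * cutoff \<delta> l) + \<tau> powr (1 - p / 2) * p powr (p / 2) * (G l * (\<delta> / l))"
proof -
  define c where "c = 1 - \<delta> / l"
  define q where "q = p / 2"
  have c: "0 < c" "c \<le> 1" using assms by (auto simp: c_def)
  have l: "l > 0" "h l > 0" using assms h_pos by auto
  have q: "q \<ge> 1" using p by (simp add: q_def)
  \<comment> \<open>Chosen so that \<open>h l * w * c powr (p - 2)\<close> is the left-hand side.\<close>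
  define w where "w = p * \<bar>T l\<bar> / l * (\<delta> / l) * c"
  have w: "w \<ge> 0" unfolding w_def using p l c assms by simp
  have "w * (c powr 2) powr (q - 1) \<le> \<tau> * (c powr 2) powr q + \<tau> powr (1 - q) * w powr q"
    using q w assms by (intro young_powr_small) auto
  moreover have "(c powr 2) powr q = c powr p" "(c powr 2) powr (q - 1) = c powr (p - 2)"
    by (simp_all add: powr_powr q_def algebra_simps)
  moreover have "w powr q \<le> p powr q * (\<bar>T l\<bar> powr q / l powr q) * (\<delta> / l)"
  proof -
    have dl: "0 < \<delta> / l" "\<delta> / l \<le> 1" using assms by auto
    have "w powr q = (p * \<bar>T l\<bar> / l) powr q * (\<delta> / l) powr q * c powr q"
      unfolding w_def powr_mult[of _ c q] powr_mult[of _ "\<delta> / l" q] ..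
    also have "\<dots> \<le> (p * \<bar>T l\<bar> / l) powr q * (\<delta> / l) * 1"
    proof (intro mult_mono)
      show "(\<delta> / l) powr q \<le> \<delta> / l"
        using powr_mono'[of 1 q "\<delta> / l"] dl q by simp
      show "c powr q \<le> 1" using c q by (intro powr_le1) auto
      show "0 \<le> (p * \<bar>T l\<bar> / l) powr q * (\<delta> / l)"
        using dl by (intro mult_nonneg_nonneg) auto
    qed (use dl in auto)
    also have "(p * \<bar>T l\<bar> / l) powr q = p powr q * (\<bar>T l\<bar> powr q / l powr q)"
      using p l by (simp add: powr_divide powr_mult)
    finally show ?thesis by simp
  qed
  ultimately have "w * c powr (p - 2)
      \<le> \<tau> * c powr p + \<tau> powr (1 - q) * (p powr q * (\<bar>T l\<bar> powr q / l powr q) * (\<delta> / l))"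
    by (smt (verit) mult_left_mono powr_ge_zero)
  then have "h l * (w * c powr (p - 2))
      \<le> h l * (\<tau> * c powr p + \<tau> powr (1 - q) * (p powr q * (\<bar>T l\<bar> powr q / l powr q) * (\<delta> / l)))"
    using l by (intro mult_left_mono) auto
  moreover have "h l * (w * c powr (p - 2)) = \<bar>H l\<bar> * cutoff' \<delta> l"
  proof -
    have "c powr (p - 1) = c * c powr (p - 2)"
      using c powr_add[of c 1 "p - 2"] by simp
    then show ?thesis
      using assms l by (simp add: w_def H_eq cutoff'_eq abs_mult power2_eq_square c_def)
  qed
  moreover have "h l * (\<tau> * c powr p + \<tau> powr (1 - q) * (p powr q * (\<bar>T l\<bar> powr q / l powr q) * (\<delta> / l)))
      = \<tau> * (h l * cutoff \<delta> l) + \<tau> powr (1 - p / 2) * p powr (p / 2) * (G l * (\<delta> / l))"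
    using assms by (simp add: cutoff_eq c_def q_def G_def G_fun_def T_def algebra_simps)
  ultimately show ?thesis by simp
qed

text \<open>
  The integrand of the right-hand side as a function of \<open>z = f'' x\<close> and \<open>l = \<bar>f x\<bar>\<close>.
\<close>

definition rhs_density :: "real \<Rightarrow> real \<Rightarrow> real" where
  "rhs_density z l = \<bar>z * T l\<bar> powr (p / 2) * h l"

text \<open>
  The part of \<open>H_cutoff'_le\<close> that depends on \<open>G\<close>.
\<close>

definition cutoff_err :: "real \<Rightarrow> real \<Rightarrow> real" where
  "cutoff_err \<delta> l = (if l \<le> \<delta> then 0 else G l * (\<delta> / l))"

text \<open>
  Here \<open>s = f x\<close>, \<open>y = f' x\<close> and \<open>z = f'' x\<close>; the sum in parentheses on the right is the derivative
  of \<open>phi p (f' x) * Psi \<delta> (f x)\<close>.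
\<close>

lemma pointwise_estimate:
  assumes "\<delta> > 0" "\<tau> > 0" "s \<noteq> 0"
  shows "(2 / p - \<tau>) * (\<bar>y\<bar> powr p * h_cut \<delta> s)
    \<le> (phi' p y * z * Psi \<delta> s + phi p y * (Psi' \<delta> s * y))
      + 2 / p * ((p - 1) powr (p / 2) * rhs_density z \<bar>s\<bar>)
      + \<tau> powr (1 - p / 2) * p powr (p / 2) * (\<bar>y\<bar> powr p * cutoff_err \<delta> \<bar>s\<bar>)"
proof (cases "\<bar>s\<bar> \<le> \<delta>")
  case True
  then have "h_cut \<delta> s = 0" "Psi \<delta> s = 0" "Psi' \<delta> s = 0" "cutoff_err \<delta> \<bar>s\<bar> = 0"
    using assms by (simp_all add: h_cut_def Psi_def Psi'_def cutoff_err_def cutoff_eq_0 cutoff'_eq_0)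
  moreover have "0 \<le> rhs_density z \<bar>s\<bar>" using h_pos[of "\<bar>s\<bar>"] assms by (simp add: rhs_density_def)
  ultimately show ?thesis using p by simp
next
  case False
  define l where "l = \<bar>s\<bar>"
  have l: "l > \<delta>" "l > 0" "h l > 0" using False assms h_pos by (auto simp: l_def)
  have m: "max \<delta> \<bar>s\<bar> = l" using l by (simp add: l_def)
  define C where "C = \<tau> powr (1 - p / 2) * p powr (p / 2)"
  define K where "K = (p - 1) powr (p / 2)"
  define Y where "Y = \<bar>y\<bar> powr p"
  define c where "c = cutoff \<delta> l"
  have c: "0 \<le> c" "c \<le> 1"
    using l assms p by (auto simp: c_def cutoff_eq intro!: powr_le1)
  have Y: "Y \<ge> 0" by (simp add: Y_def)
  have K: "K \<ge> 0" by (simp add: K_def)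
  have phi'0: "phi' p y \<ge> 0" using p by (simp add: phi'_def)
  have rhs_density: "rhs_density z l = h l * \<bar>z * T l\<bar> powr (p / 2)" by (simp add: rhs_density_def)
  then have beta0: "rhs_density z l \<ge> 0" using l by simp
  have 1: "phi' p y * \<bar>z * H l\<bar> \<le> (1 - 2 / p) * (Y * h l) + 2 / p * (K * rhs_density z l)"
  proof -
    have "phi' p y * \<bar>z * T l\<bar> \<le> (1 - 2 / p) * Y + 2 / p * (K * \<bar>z * T l\<bar> powr (p / 2))"
      unfolding Y_def K_def using p by (intro phi'_young) auto
    then have "h l * (phi' p y * \<bar>z * T l\<bar>) \<le> h l * ((1 - 2 / p) * Y + 2 / p * (K * \<bar>z * T l\<bar> powr (p / 2)))"
      using l by (intro mult_left_mono) auto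
    then show ?thesis using l by (simp add: H_eq rhs_density abs_mult algebra_simps)
  qed
  have 2: "phi' p y * \<bar>z * H l\<bar> * c \<le> (1 - 2 / p) * (Y * h l * c) + 2 / p * (K * rhs_density z l)"
  proof -
    have "phi' p y * \<bar>z * H l\<bar> * c \<le> ((1 - 2 / p) * (Y * h l) + 2 / p * (K * rhs_density z l)) * c"
      using 1 c by (intro mult_right_mono)
    also have "\<dots> = (1 - 2 / p) * (Y * h l * c) + (2 / p * (K * rhs_density z l)) * c"
      by (simp add: algebra_simps)
    also have "(2 / p * (K * rhs_density z l)) * c \<le> 2 / p * (K * rhs_density z l)"
      using c p K beta0 by (intro mult_left_le) auto
    finally show ?thesis by simp
  qed
  have 3: "Y * (\<bar>H l\<bar> * cutoff' \<delta> l) \<le> Y * (\<tau> * (h l * c) + C * (G l * (\<delta> / l)))"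
    unfolding C_def c_def using H_cutoff'_le[of \<delta> l \<tau>] l assms Y by (intro mult_left_mono) auto
  have cutoff'0: "cutoff' \<delta> l \<ge> 0" using l assms p by (simp add: cutoff'_eq)
  have "phi' p y * z * Psi \<delta> s \<ge> - (phi' p y * \<bar>z * H l\<bar> * c)"
  proof -
    have "\<bar>phi' p y * z * Psi \<delta> s\<bar> = phi' p y * \<bar>z * H l\<bar> * c"
      using phi'0 c assms by (simp add: Psi_def l_def[symmetric] c_def[symmetric] abs_mult abs_sgn_eq)
    then show ?thesis by linarith
  qed
  moreover have "phi p y * (Psi' \<delta> s * y) = Y * (h l * c) + Y * (H l * cutoff' \<delta> l)"
  proof -
    have "phi p y * (Psi' \<delta> s * y) = Y * Psi' \<delta> s"
      using phi_mult_self[OF p, of y] by (simp add: Y_def mult_ac)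
    then show ?thesis
      using m by (simp add: Psi'_def h_cut_def l_def[symmetric] c_def[symmetric] algebra_simps)
  qed
  moreover have "Y * (H l * cutoff' \<delta> l) \<ge> - (Y * (\<bar>H l\<bar> * cutoff' \<delta> l))"
  proof -
    have "- \<bar>H l\<bar> * (Y * cutoff' \<delta> l) \<le> H l * (Y * cutoff' \<delta> l)"
      using Y cutoff'0 by (intro mult_right_mono) auto
    then show ?thesis by (simp add: algebra_simps)
  qed
  moreover have vals: "h_cut \<delta> s = h l * c" "cutoff_err \<delta> \<bar>s\<bar> = G l * (\<delta> / l)"
    using m l by (simp_all add: h_cut_def cutoff_err_def l_def[symmetric] c_def[symmetric])
  moreover have "(2 / p - \<tau>) * (Y * (h l * c)) = Y * (h l * c) - (1 - 2 / p) * (Y * h l * c) - Y * (\<tau> * (h l * c))"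
    by (simp add: algebra_simps)
  moreover have "Y * (\<tau> * (h l * c) + C * (G l * (\<delta> / l))) = Y * (\<tau> * (h l * c)) + C * (Y * (G l * (\<delta> / l)))"
    by (simp add: algebra_simps)
  ultimately show ?thesis
    using 2 3 unfolding Y_def[symmetric] C_def[symmetric] K_def[symmetric] vals
    unfolding l_def[symmetric] by linarith
qed

end

section \<open>The estimate on compact intervals\<close>

lemma nn_integral_restrict_support:
  assumes "S \<in> sets lebesgue"
  shows "(\<integral>\<^sup>+ x \<in> S \<inter> {x. P x}. ennreal (w x) \<partial>lebesgue)
       = (\<integral>\<^sup>+ x. ennreal (if P x then w x else 0) \<partial>lebesgue_on S)"
  using assms by (subst nn_integral_restrict_space) (auto intro!: nn_integral_cong simp: indicator_def)

lemma nn_integral_finite_imp_integral: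
  fixes u :: "real \<Rightarrow> real"
  assumes S: "S \<in> sets lebesgue" and u: "u \<in> borel_measurable (lebesgue_on S)"
    and nonneg: "\<And>x. 0 \<le> u x" and fin: "(\<integral>\<^sup>+ x. ennreal (u x) \<partial>lebesgue_on S) < \<infinity>"
  shows "u integrable_on S" "(\<integral>\<^sup>+ x. ennreal (u x) \<partial>lebesgue_on S) = ennreal (integral S u)"
proof -
  have int: "integrable (lebesgue_on S) u"
    using u nonneg fin by (intro integrableI_nonneg) auto
  then show "u integrable_on S" using S by (rule integrable_on_lebesgue_on)
  show "(\<integral>\<^sup>+ x. ennreal (u x) \<partial>lebesgue_on S) = ennreal (integral S u)"
    using nn_integral_eq_integral[OF int] nonneg lebesgue_integral_eq_integral[OF int S] by simp
qed

lemma integrable_imp_nn_integral: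
  fixes u :: "real \<Rightarrow> real"
  assumes S: "S \<in> sets lebesgue" and u: "u integrable_on S" and nonneg: "\<And>x. 0 \<le> u x"
  shows "(\<integral>\<^sup>+ x. ennreal (u x) \<partial>lebesgue_on S) = ennreal (integral S u)"
proof -
  have int: "integrable (lebesgue_on S) u"
    using u nonneg S by (intro absolutely_integrable_imp_integrable nonnegative_absolutely_integrable_1)
  show ?thesis
    using nn_integral_eq_integral[OF int] nonneg lebesgue_integral_eq_integral[OF int S] by simp
qed

lemma borel_measurable_extend_zero:
  fixes g :: "real \<Rightarrow> real"
  assumes "continuous_on {0<..} g"
  shows "(\<lambda>s. if s \<noteq> 0 then g \<bar>s\<bar> else 0) \<in> borel_measurable borel"
proof -
  have "(\<lambda>s. if s \<in> - {0::real} then g \<bar>s\<bar> else 0) \<in> borel_measurable borel"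
    by (intro borel_measurable_continuous_on_if continuous_on_compose2[OF assms] continuous_intros) auto
  then show ?thesis by simp
qed

context weight
begin

lemma continuous_on_T: "continuous_on {0<..} T"
  unfolding T_def T_trans_def
  by (intro continuous_on_divide continuous_on_H h_cont ballI) (simp add: h_pos less_imp_neq[OF h_pos, symmetric])

lemma continuous_on_G: "continuous_on {0<..} G"
proof -
  have "continuous_on {0<..} (\<lambda>l. \<bar>T l\<bar> powr (p / 2) * h l / l powr (p / 2))"
    using p by (intro continuous_on_divide continuous_on_mult continuous_on_powr' h_cont
        continuous_on_T continuous_intros) auto
  then show ?thesis by (simp add: G_def G_fun_def T_def fun_eq_iff)
qed

text \<open>
  The boundary term without the indicator function, which is redundant because \<open>sgn 0 = 0\<close>.
\<close>

definition bdry_term :: "(real \<Rightarrow> real) \<Rightarrow> real \<Rightarrow> real" where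
  "bdry_term f x = phi p (deriv f x) * (sgn (f x) * H \<bar>f x\<bar>)"

lemma boundary_term_eq: "boundary_term p H f x = bdry_term f x"
  by (cases "f x = 0") (simp_all add: boundary_term_def bdry_term_def phi_def)

lemma Psi_tendsto:
  assumes "\<And>n. d n > 0" "d \<longlonglongrightarrow> 0"
  shows "(\<lambda>n. Psi (d n) s) \<longlonglongrightarrow> sgn s * H \<bar>s\<bar>"
proof (cases "s = 0")
  case False
  then have "eventually (\<lambda>n. d n < \<bar>s\<bar>) sequentially"
    using assms(2) by (intro order_tendstoD(2)) auto
  then have "eventually (\<lambda>n. sgn s * H \<bar>s\<bar> * (1 - d n / \<bar>s\<bar>) powr p = Psi (d n) s) sequentially"
    by eventually_elim (simp add: Psi_def cutoff_eq assms(1))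
  moreover have "(\<lambda>n. sgn s * H \<bar>s\<bar> * (1 - d n / \<bar>s\<bar>) powr p) \<longlonglongrightarrow> sgn s * H \<bar>s\<bar> * (1 - 0 / \<bar>s\<bar>) powr p"
    using False by (intro tendsto_intros assms(2)) auto
  ultimately show ?thesis by (auto intro: Lim_transform_eventually)
qed (simp add: Psi_def)

lemma h_cut_tendsto:
  assumes "\<And>n. d n > 0" "d \<longlonglongrightarrow> 0" "s \<noteq> 0"
  shows "(\<lambda>n. h_cut (d n) s) \<longlonglongrightarrow> h \<bar>s\<bar>"
proof -
  have "eventually (\<lambda>n. d n < \<bar>s\<bar>) sequentially"
    using assms by (intro order_tendstoD(2)) auto
  then have "eventually (\<lambda>n. h \<bar>s\<bar> * (1 - d n / \<bar>s\<bar>) powr p = h_cut (d n) s) sequentially"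
    by eventually_elim (simp add: h_cut_def cutoff_eq assms(1) max_def)
  moreover have "(\<lambda>n. h \<bar>s\<bar> * (1 - d n / \<bar>s\<bar>) powr p) \<longlonglongrightarrow> h \<bar>s\<bar> * (1 - 0 / \<bar>s\<bar>) powr p"
    using assms by (intro tendsto_intros assms(2)) auto
  ultimately show ?thesis by (auto intro: Lim_transform_eventually)
qed

lemma cutoff_err_bounds:
  assumes "\<delta> > 0" "l > 0"
  shows "0 \<le> cutoff_err \<delta> l" "cutoff_err \<delta> l \<le> G l" "cutoff_err \<delta> l \<le> G l * (\<delta> / l)"
proof -
  show "0 \<le> cutoff_err \<delta> l" using G_nonneg[OF assms(2)] assms by (simp add: cutoff_err_def)
  show "cutoff_err \<delta> l \<le> G l" using G_nonneg[OF assms(2)] assms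
    by (auto simp: cutoff_err_def divide_simps mult_left_mono)
  show "cutoff_err \<delta> l \<le> G l * (\<delta> / l)" using G_nonneg[OF assms(2)] assms by (simp add: cutoff_err_def)
qed

text \<open>
  The pointwise estimate is integrated over \<open>{r..R}\<close>, then \<open>\<delta>\<close> tends to \<open>0\<close> along \<open>d n\<close>,
  and finally \<open>\<tau>\<close> tends to \<open>0\<close>.  The finiteness of the left-hand side is part of the conclusion.
\<close>

theorem local_estimate:
  fixes f :: "real \<Rightarrow> real"
  assumes rR: "r < R"
    and f_diff: "\<And>x. x \<in> {r..R} \<Longrightarrow> f differentiable (at x)"
    and AC: "AC_on {r..R} (deriv f)"
    and \<epsilon>: "\<epsilon> > 0"
    and finG: "(\<integral>\<^sup>+ x \<in> {r..R} \<inter> {x. 0 < \<bar>f x\<bar> \<and> \<bar>f x\<bar> < \<epsilon>}.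
                  ennreal (\<bar>deriv f x\<bar> powr p * G \<bar>f x\<bar>) \<partial>lebesgue) < \<infinity>"
    and finB: "(\<integral>\<^sup>+ x \<in> {r..R} \<inter> {x. f x \<noteq> 0}. ennreal (rhs_density (deriv (deriv f) x) \<bar>f x\<bar>) \<partial>lebesgue) < \<infinity>"
  shows "(\<integral>\<^sup>+ x \<in> {r..R} \<inter> {x. f x \<noteq> 0}. ennreal (\<bar>deriv f x\<bar> powr p * h \<bar>f x\<bar>) \<partial>lebesgue)
    \<le> ennreal (p / 2 * (bdry_term f R - bdry_term f r) + (p - 1) powr (p / 2) *
        enn2real (\<integral>\<^sup>+ x \<in> {r..R} \<inter> {x. f x \<noteq> 0}. ennreal (rhs_density (deriv (deriv f) x) \<bar>f x\<bar>) \<partial>lebesgue))"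
proof -
  define J where "J = {r..R}"
  define v where "v = deriv f"
  define z where "z = deriv v"
  define K where "K = (p - 1) powr (p / 2)"
  have J: "J \<in> sets lebesgue" by (simp add: J_def)
  have f_deriv: "(f has_real_derivative v x) (at x)" if "x \<in> J" for x
    using f_diff that by (simp add: J_def v_def DERIV_deriv_iff_real_differentiable)
  have ACv: "AC_on {r..R} v" using AC by (simp add: v_def)
  have f_cont: "continuous_on J f"
    by (rule DERIV_continuous_on[of _ _ v]) (use f_deriv has_field_derivative_at_within in blast)
  have v_cont: "continuous_on J v" using AC_on_imp_continuous_on[OF ACv] by (simp add: J_def)
  have f_meas [measurable]: "f \<in> borel_measurable (lebesgue_on J)"
    using f_cont J by (rule continuous_imp_measurable_on_sets_lebesgue)
  have v_meas [measurable]: "v \<in> borel_measurable (lebesgue_on J)"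
    using v_cont J by (rule continuous_imp_measurable_on_sets_lebesgue)
  define N where "N = {x \<in> {r<..<R}. \<not> v differentiable (at x)} \<union> {r, R}"
  have N: "negligible N"
    unfolding N_def using AC_on_differentiable_ae[OF ACv] by (intro negligible_Un) simp_all
  have v_deriv: "(v has_real_derivative z x) (at x)" if "x \<in> J - N" for x
    using that by (auto simp: J_def N_def z_def DERIV_deriv_iff_real_differentiable)
  have "(z has_integral (v R - v r)) {r..R}"
  proof (rule AC_on_fundamental_theorem_of_calculus[OF ACv _ N])
    show "(v has_real_derivative z x) (at x within {r..R})" if "x \<in> {r..R} - N" for x
      by (rule has_field_derivative_at_within[OF v_deriv]) (use that in \<open>simp add: J_def\<close>)
  qed (use rR in simp)
  then have "z integrable_on J" unfolding J_def by (rule has_integral_integrable)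
  then have z_meas [measurable]: "z \<in> borel_measurable (lebesgue_on J)"
    by (rule integrable_imp_measurable)
  have comp_meas: "(\<lambda>x. if f x \<noteq> 0 then g \<bar>f x\<bar> else 0) \<in> borel_measurable (lebesgue_on J)"
    if "continuous_on {0<..} g" for g :: "real \<Rightarrow> real"
    by (rule measurable_compose[OF f_meas borel_measurable_extend_zero[OF that]])

  define b where "b = (\<lambda>x. if f x \<noteq> 0 then rhs_density (z x) \<bar>f x\<bar> else 0)"
  have b_nonneg: "0 \<le> b x" for x
    using h_pos[of "\<bar>f x\<bar>"] by (simp add: b_def rhs_density_def less_imp_le)
  have b_meas: "b \<in> borel_measurable (lebesgue_on J)"
  proof -
    note [measurable] = comp_meas[OF continuous_on_T] comp_meas[OF h_cont]
    have "(\<lambda>x. \<bar>z x * (if f x \<noteq> 0 then T \<bar>f x\<bar> else 0)\<bar> powr (p / 2) * (if f x \<noteq> 0 then h \<bar>f x\<bar> else 0))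
        \<in> borel_measurable (lebesgue_on J)" by measurable
    also have "(\<lambda>x. \<bar>z x * (if f x \<noteq> 0 then T \<bar>f x\<bar> else 0)\<bar> powr (p / 2) * (if f x \<noteq> 0 then h \<bar>f x\<bar> else 0)) = b"
      by (auto simp: b_def rhs_density_def fun_eq_iff)
    finally show ?thesis .
  qed
  have nn_b: "(\<integral>\<^sup>+ x \<in> {r..R} \<inter> {x. f x \<noteq> 0}. ennreal (rhs_density (deriv (deriv f) x) \<bar>f x\<bar>) \<partial>lebesgue)
      = (\<integral>\<^sup>+ x. ennreal (b x) \<partial>lebesgue_on J)"
    using nn_integral_restrict_support[OF J, where P = "\<lambda>x. f x \<noteq> 0" and w = "\<lambda>x. rhs_density (z x) \<bar>f x\<bar>"]
    by (simp add: b_def J_def z_def v_def)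
  have "(\<integral>\<^sup>+ x. ennreal (b x) \<partial>lebesgue_on J) < \<infinity>" using finB nn_b by simp
  note b_int = nn_integral_finite_imp_integral[OF J b_meas b_nonneg this]
  define B where "B = integral J b"
  have B: "enn2real (\<integral>\<^sup>+ x \<in> {r..R} \<inter> {x. f x \<noteq> 0}. ennreal (rhs_density (deriv (deriv f) x) \<bar>f x\<bar>) \<partial>lebesgue) = B"
    unfolding nn_b b_int(2) B_def by (intro enn2real_ennreal integral_nonneg b_int(1) b_nonneg)

  define g where "g = (\<lambda>x. if f x \<noteq> 0 then \<bar>v x\<bar> powr p * G \<bar>f x\<bar> else 0)"
  have g_nonneg: "0 \<le> g x" for x
    using G_nonneg[of "\<bar>f x\<bar>"] by (simp add: g_def)
  have g_meas [measurable]: "g \<in> borel_measurable (lebesgue_on J)"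
  proof -
    note [measurable] = comp_meas[OF continuous_on_G]
    have "(\<lambda>x. \<bar>v x\<bar> powr p * (if f x \<noteq> 0 then G \<bar>f x\<bar> else 0)) \<in> borel_measurable (lebesgue_on J)"
      by measurable
    also have "(\<lambda>x. \<bar>v x\<bar> powr p * (if f x \<noteq> 0 then G \<bar>f x\<bar> else 0)) = g"
      by (auto simp: g_def fun_eq_iff)
    finally show ?thesis .
  qed
  have "(\<integral>\<^sup>+ x. ennreal (g x) \<partial>lebesgue_on J) < \<infinity>"
  proof -
    \<comment> \<open>Where \<open>\<bar>f x\<bar> \<ge> \<epsilon>\<close>, the integrand is bounded by compactness.\<close>
    have "continuous_on J (\<lambda>x. \<bar>v x\<bar> powr p * G (max \<epsilon> \<bar>f x\<bar>))"
      using p \<epsilon> by (intro continuous_on_mult continuous_on_powr' continuous_on_compose2[OF continuous_on_G]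
          continuous_intros v_cont f_cont) auto
    then obtain M where M: "M \<ge> 0" "\<forall>x\<in>J. \<bar>\<bar>v x\<bar> powr p * G (max \<epsilon> \<bar>f x\<bar>)\<bar> \<le> M"
      unfolding J_def by (rule continuous_on_Icc_bounded)
    define u where "u = (\<lambda>x. if 0 < \<bar>f x\<bar> \<and> \<bar>f x\<bar> < \<epsilon> then \<bar>v x\<bar> powr p * G \<bar>f x\<bar> else 0)"
    have u_eq: "u = (\<lambda>x. if \<bar>f x\<bar> < \<epsilon> then g x else 0)" by (auto simp: u_def g_def fun_eq_iff)
    have u_meas: "u \<in> borel_measurable (lebesgue_on J)" unfolding u_eq by measurable
    have "(\<integral>\<^sup>+ x. ennreal (g x) \<partial>lebesgue_on J) \<le> (\<integral>\<^sup>+ x. ennreal (u x) + ennreal M \<partial>lebesgue_on J)"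
    proof (rule nn_integral_mono)
      fix x assume "x \<in> space (lebesgue_on J)"
      then have "x \<in> J" by simp
      have "g x \<le> u x + M"
      proof (cases "\<bar>f x\<bar> < \<epsilon>")
        case False
        then have "max \<epsilon> \<bar>f x\<bar> = \<bar>f x\<bar>" by simp
        then show ?thesis using M(2) \<open>x \<in> J\<close> False by (force simp: g_def u_eq)
      qed (use M(1) in \<open>simp add: u_eq\<close>)
      moreover have "0 \<le> u x" using g_nonneg[of x] by (simp add: u_eq)
      ultimately show "ennreal (g x) \<le> ennreal (u x) + ennreal M"
        using M(1) by (simp flip: ennreal_plus add: ennreal_leI)
    qed
    also have "\<dots> = (\<integral>\<^sup>+ x. ennreal (u x) \<partial>lebesgue_on J) + (\<integral>\<^sup>+ x. ennreal M \<partial>lebesgue_on J)"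
      using u_meas by (intro nn_integral_add) auto
    also have "\<dots> < \<infinity>"
    proof -
      have "(\<integral>\<^sup>+ x. ennreal (u x) \<partial>lebesgue_on J) < \<infinity>"
        using finG nn_integral_restrict_support[OF J, where P = "\<lambda>x. 0 < \<bar>f x\<bar> \<and> \<bar>f x\<bar> < \<epsilon>" and w = "\<lambda>x. \<bar>v x\<bar> powr p * G \<bar>f x\<bar>"]
        by (simp add: u_def J_def v_def)
      moreover have "(\<integral>\<^sup>+ x. ennreal M \<partial>lebesgue_on J) < \<infinity>"
        using rR by (simp add: nn_integral_const emeasure_restrict_space J_def ennreal_mult_less_top)
      ultimately show ?thesis by simp
    qed
    finally show ?thesis .
  qed
  note g_int = nn_integral_finite_imp_integral[OF J g_meas g_nonneg this]

  define d where "d = (\<lambda>n. inverse (real (Suc n)))"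
  have d_pos: "d n > 0" for n by (simp add: d_def)
  have d_lim: "d \<longlonglongrightarrow> 0" unfolding d_def by (rule LIMSEQ_inverse_real_of_nat)

  define e where "e = (\<lambda>n x. if f x \<noteq> 0 then \<bar>v x\<bar> powr p * cutoff_err (d n) \<bar>f x\<bar> else 0)"
  have e_bounds: "0 \<le> e n x" "e n x \<le> g x" for n x
    using cutoff_err_bounds[OF d_pos[of n], of "\<bar>f x\<bar>"] by (auto simp: e_def g_def intro!: mult_left_mono)
  have e_int: "e n integrable_on J" for n
  proof (rule measurable_bounded_by_integrable_imp_integrable_real[OF _ g_int(1) _ J])
    have "(\<lambda>x. if \<bar>f x\<bar> \<le> d n then 0 else g x * (d n / \<bar>f x\<bar>)) \<in> borel_measurable (lebesgue_on J)"
      by measurable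
    also have "(\<lambda>x. if \<bar>f x\<bar> \<le> d n then 0 else g x * (d n / \<bar>f x\<bar>)) = e n"
      using d_pos[of n] by (auto simp: e_def g_def cutoff_err_def fun_eq_iff)
    finally show "e n \<in> borel_measurable (lebesgue_on J)" .
    show "\<bar>e n x\<bar> \<le> g x" for x using e_bounds[of n x] by simp
  qed
  have e_lim: "(\<lambda>n. integral J (e n)) \<longlonglongrightarrow> integral J (\<lambda>x. 0 :: real)"
  proof (rule dominated_convergence(2)[OF e_int g_int(1)])
    show "norm (e n x) \<le> g x" for n x using e_bounds[of n x] by simp
    show "(\<lambda>n. e n x) \<longlonglongrightarrow> 0" for x
    proof (cases "f x = 0")
      case False
      have "(\<lambda>n. \<bar>v x\<bar> powr p * (G \<bar>f x\<bar> * (d n / \<bar>f x\<bar>))) \<longlonglongrightarrow> \<bar>v x\<bar> powr p * (G \<bar>f x\<bar> * (0 / \<bar>f x\<bar>))"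
        using False by (intro tendsto_intros d_lim) auto
      then have *: "(\<lambda>n. \<bar>v x\<bar> powr p * (G \<bar>f x\<bar> * (d n / \<bar>f x\<bar>))) \<longlonglongrightarrow> 0" by simp
      show ?thesis
      proof (rule tendsto_sandwich[OF _ _ tendsto_const *])
        show "\<forall>\<^sub>F n in sequentially. 0 \<le> e n x" using e_bounds by simp
        show "\<forall>\<^sub>F n in sequentially. e n x \<le> \<bar>v x\<bar> powr p * (G \<bar>f x\<bar> * (d n / \<bar>f x\<bar>))"
        proof (intro always_eventually allI)
          fix n
          have "cutoff_err (d n) \<bar>f x\<bar> \<le> G \<bar>f x\<bar> * (d n / \<bar>f x\<bar>)"
            using False by (intro cutoff_err_bounds(3) d_pos) simp
          then have "\<bar>v x\<bar> powr p * cutoff_err (d n) \<bar>f x\<bar> \<le> \<bar>v x\<bar> powr p * (G \<bar>f x\<bar> * (d n / \<bar>f x\<bar>))"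
            by (rule mult_left_mono) simp
          then show "e n x \<le> \<bar>v x\<bar> powr p * (G \<bar>f x\<bar> * (d n / \<bar>f x\<bar>))"
            using False by (simp only: e_def if_True not_False_eq_True)
        qed
      qed
    qed (simp add: e_def)
  qed

  define k where "k = (\<lambda>n x. \<bar>v x\<bar> powr p * h_cut (d n) (f x))"
  have k_nonneg: "0 \<le> k n x" for n x unfolding k_def by (intro mult_nonneg_nonneg h_cut_nonneg d_pos) simp
  have k_cont: "continuous_on J (k n)" for n
    unfolding k_def using p
    by (intro continuous_on_mult continuous_on_powr' continuous_on_compose2[OF continuous_on_h_cut[OF d_pos]]
        continuous_intros v_cont f_cont) auto
  have k_int: "k n integrable_on J" for n
    using k_cont[of n] unfolding J_def by (rule integrable_continuous_interval)
  have k_meas: "k n \<in> borel_measurable (lebesgue_on J)" for n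
    using k_cont J by (rule continuous_imp_measurable_on_sets_lebesgue)

  define \<Phi> where "\<Phi> = (\<lambda>n x. phi p (v x) * Psi (d n) (f x))"
  define D where "D = (\<lambda>n x. phi' p (v x) * z x * Psi (d n) (f x) + phi p (v x) * (Psi' (d n) (f x) * v x))"
  have D_int: "(D n has_integral (\<Phi> n R - \<Phi> n r)) J" for n
    unfolding J_def
  proof (rule AC_on_fundamental_theorem_of_calculus[OF _ _ N])
    have Psi_f: "((\<lambda>x. Psi (d n) (f x)) has_real_derivative Psi' (d n) (f x) * v x) (at x)" if "x \<in> J" for x
      by (rule DERIV_chain2[OF Psi_has_derivative[OF d_pos] f_deriv[OF that]])
    have "continuous_on J (\<lambda>x. Psi' (d n) (f x) * v x)"
      by (intro continuous_on_mult continuous_on_compose2[OF continuous_on_Psi'[OF d_pos]] f_cont v_cont) auto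
    then obtain L where "L \<ge> 0" and L: "\<forall>x\<in>J. \<bar>Psi' (d n) (f x) * v x\<bar> \<le> L"
      unfolding J_def by (rule continuous_on_Icc_bounded)
    have "AC_on {r..R} (\<lambda>x. Psi (d n) (f x))"
      by (rule AC_on_bounded_deriv[of _ _ _ "\<lambda>x. Psi' (d n) (f x) * v x" L]) (use Psi_f L in \<open>auto simp: J_def\<close>)
    moreover have "AC_on {r..R} (\<lambda>x. phi p (v x))"
      by (rule AC_on_compose[OF ACv phi_has_derivative[OF p] continuous_on_phi'[OF p]])
    ultimately show "AC_on {r..R} (\<Phi> n)" unfolding \<Phi>_def by (intro AC_on_mult)
    fix x assume x: "x \<in> {r..R} - N"
    have "((\<lambda>x. phi p (v x)) has_real_derivative phi' p (v x) * z x) (at x)"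
      by (rule DERIV_chain2[OF phi_has_derivative[OF p] v_deriv]) (use x in \<open>simp add: J_def\<close>)
    from DERIV_mult'[OF this Psi_f] have "(\<Phi> n has_real_derivative D n x) (at x)"
      using x unfolding \<Phi>_def D_def by (simp add: J_def add.commute)
    then show "(\<Phi> n has_real_derivative D n x) (at x within {r..R})"
      by (rule has_field_derivative_at_within)
  qed (use rR in simp)

  have main: "(2 / p - \<tau>) * integral J (k n) \<le> (\<Phi> n R - \<Phi> n r) + 2 / p * (K * B)
      + \<tau> powr (1 - p / 2) * p powr (p / 2) * integral J (e n)" if "\<tau> > 0" for \<tau> n
  proof (rule has_integral_le)
    show "((\<lambda>x. (2 / p - \<tau>) * k n x) has_integral (2 / p - \<tau>) * integral J (k n)) J"
      by (intro has_integral_mult_right integrable_integral k_int)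
    show "((\<lambda>x. D n x + 2 / p * (K * b x) + \<tau> powr (1 - p / 2) * p powr (p / 2) * e n x)
        has_integral (\<Phi> n R - \<Phi> n r) + 2 / p * (K * B) + \<tau> powr (1 - p / 2) * p powr (p / 2) * integral J (e n)) J"
      unfolding B_def
      by (intro has_integral_add has_integral_mult_right integrable_integral D_int e_int b_int(1))
    fix x
    show "(2 / p - \<tau>) * k n x \<le> D n x + 2 / p * (K * b x) + \<tau> powr (1 - p / 2) * p powr (p / 2) * e n x"
    proof (cases "f x = 0")
      case True
      then show ?thesis
        using d_pos[of n] by (simp add: k_def D_def b_def e_def h_cut_def Psi_def Psi'_def cutoff_eq_0 cutoff'_eq_0)
    next
      case False
      from pointwise_estimate[OF d_pos[of n] that False, of "v x" "z x"]
      show ?thesis using False by (simp add: k_def D_def b_def e_def K_def)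
    qed
  qed

  define A where "A = (\<integral>\<^sup>+ x. ennreal (if f x \<noteq> 0 then \<bar>v x\<bar> powr p * h \<bar>f x\<bar> else 0) \<partial>lebesgue_on J)"
  define c where "c = (\<lambda>\<tau>. ((bdry_term f R - bdry_term f r) + 2 / p * (K * B)) / (2 / p - \<tau>))"
  have A_le: "A \<le> ennreal (c \<tau>)" if \<tau>: "0 < \<tau>" "\<tau> < 2 / p" for \<tau>
  proof -
    define C where "C = \<tau> powr (1 - p / 2) * p powr (p / 2)"
    define cn where "cn = (\<lambda>n. ((\<Phi> n R - \<Phi> n r) + 2 / p * (K * B) + C * integral J (e n)) / (2 / p - \<tau>))"
    have "(\<lambda>n. cn n) \<longlonglongrightarrow> ((bdry_term f R - bdry_term f r) + 2 / p * (K * B) + C * integral J (\<lambda>x. 0)) / (2 / p - \<tau>)"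
      unfolding cn_def bdry_term_def \<Phi>_def v_def
      by (intro tendsto_intros Psi_tendsto d_pos d_lim e_lim) (use \<tau> in auto)
    then have "cn \<longlonglongrightarrow> c \<tau>" by (simp add: c_def)
    then have cn_lim: "(\<lambda>n. ennreal (cn n)) \<longlonglongrightarrow> ennreal (c \<tau>)" by (rule tendsto_ennrealI)
    have k_le: "(\<integral>\<^sup>+ x. ennreal (k n x) \<partial>lebesgue_on J) \<le> ennreal (cn n)" for n
      unfolding integrable_imp_nn_integral[OF J k_int k_nonneg]
      using main[OF \<tau>(1), of n] \<tau> by (intro ennreal_leI) (simp add: cn_def C_def field_simps)
    have "A \<le> (\<integral>\<^sup>+ x. liminf (\<lambda>n. ennreal (k n x)) \<partial>lebesgue_on J)"
      unfolding A_def
    proof (rule nn_integral_mono)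
      fix x
      show "ennreal (if f x \<noteq> 0 then \<bar>v x\<bar> powr p * h \<bar>f x\<bar> else 0) \<le> liminf (\<lambda>n. ennreal (k n x))"
      proof (cases "f x = 0")
        case False
        have "(\<lambda>n. ennreal (k n x)) \<longlonglongrightarrow> ennreal (\<bar>v x\<bar> powr p * h \<bar>f x\<bar>)"
          unfolding k_def by (intro tendsto_ennrealI tendsto_mult tendsto_const h_cut_tendsto d_pos d_lim False)
        from lim_imp_Liminf[OF sequentially_bot this] show ?thesis using False by simp
      qed simp
    qed
    also have "\<dots> \<le> liminf (\<lambda>n. \<integral>\<^sup>+ x. ennreal (k n x) \<partial>lebesgue_on J)"
      using k_meas by (intro nn_integral_liminf) simp
    also have "\<dots> \<le> liminf (\<lambda>n. ennreal (cn n))"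
      by (intro Liminf_mono always_eventually allI k_le)
    also have "\<dots> = ennreal (c \<tau>)" by (rule lim_imp_Liminf[OF sequentially_bot cn_lim])
    finally show ?thesis .
  qed
  have "(c \<longlongrightarrow> ((bdry_term f R - bdry_term f r) + 2 / p * (K * B)) / (2 / p - 0)) (at_right 0)"
    unfolding c_def using p by (intro tendsto_intros) auto
  then have "((\<lambda>\<tau>. ennreal (c \<tau>)) \<longlongrightarrow> ennreal (((bdry_term f R - bdry_term f r) + 2 / p * (K * B)) / (2 / p - 0))) (at_right 0)"
    by (rule tendsto_ennrealI)
  moreover have "\<forall>\<^sub>F \<tau> in at_right 0. A \<le> ennreal (c \<tau>)"
    unfolding eventually_at_right_field using A_le p by (intro exI[of _ "2 / p"]) auto
  ultimately have "A \<le> ennreal (((bdry_term f R - bdry_term f r) + 2 / p * (K * B)) / (2 / p - 0))"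
    by (rule tendsto_lowerbound) simp
  also have "((bdry_term f R - bdry_term f r) + 2 / p * (K * B)) / (2 / p - 0) = p / 2 * (bdry_term f R - bdry_term f r) + K * B"
    using p by (simp add: field_simps)
  also have "A = (\<integral>\<^sup>+ x \<in> {r..R} \<inter> {x. f x \<noteq> 0}. ennreal (\<bar>deriv f x\<bar> powr p * h \<bar>f x\<bar>) \<partial>lebesgue)"
    using nn_integral_restrict_support[OF J, where P = "\<lambda>x. f x \<noteq> 0" and w = "\<lambda>x. \<bar>v x\<bar> powr p * h \<bar>f x\<bar>"]
    by (simp add: A_def J_def v_def)
  finally show ?thesis unfolding B K_def .
qed

end

section \<open>Passage to the whole interval\<close>

text \<open>
  Undefined differences evaluate to \<open>\<infinity>\<close> in the extended reals and are therefore excluded by the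
  first assumption.
\<close>

lemma ereal_separating_reals:
  fixes L M :: ereal
  assumes "L - M \<le> 0" "\<eta> > 0"
  obtains c d :: real where "L < ereal c" "ereal d < M" "c - d \<le> \<eta>"
proof (cases L)
  case (real x)
  show thesis
  proof (cases M)
    case (real y)
    then show thesis using assms \<open>L = ereal x\<close> by (intro that[of "x + \<eta> / 2" "y - \<eta> / 2"]) auto
  next
    case PInf
    then show thesis using assms real by (intro that[of "x + 1" "x + 1"]) auto
  qed (use assms real in simp)
next
  case MInf
  show thesis
  proof (cases M)
    case (real y)
    then show thesis using assms MInf by (intro that[of "y - 1" "y - 1"]) auto
  next
    case PInf
    then show thesis using assms MInf by (intro that[of 0 0]) auto
  qed (use assms MInf in simp)
qed (use assms in simp)

lemma Liminf_at_left_less: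
  fixes u :: "real \<Rightarrow> real"
  assumes "Liminf (inf (filtercomap ereal (at_left b)) (principal A)) (\<lambda>x. ereal (u x)) < ereal c"
    and "ereal R0 < b"
  obtains R where "R \<in> A" "R0 < R" "u R < c"
proof -
  have "\<exists>R\<in>A. R0 < R \<and> u R < c"
  proof (rule ccontr)
    assume none: "\<not> ?thesis"
    have "eventually (\<lambda>y. ereal R0 < y) (at_left b)"
      using assms(2) eventually_at_left[of "ereal R0" b] by blast
    then have "eventually (\<lambda>x. R0 < x) (filtercomap ereal (at_left b))"
      unfolding eventually_filtercomap by (intro exI[of _ "\<lambda>y. ereal R0 < y"]) simp
    then have "eventually (\<lambda>x. x \<in> A \<longrightarrow> ereal c \<le> ereal (u x)) (filtercomap ereal (at_left b))"
      by eventually_elim (use none in \<open>auto simp: not_less\<close>)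
    then have "ereal c \<le> Liminf (inf (filtercomap ereal (at_left b)) (principal A)) (\<lambda>x. ereal (u x))"
      by (intro Liminf_bounded) (simp add: eventually_inf_principal)
    with assms(1) show False by simp
  qed
  then show thesis using that by blast
qed

lemma Limsup_at_right_greater:
  fixes u :: "real \<Rightarrow> real"
  assumes "ereal d < Limsup (inf (filtercomap ereal (at_right a)) (principal A)) (\<lambda>x. ereal (u x))"
    and "a < ereal r0"
  obtains r where "r \<in> A" "r < r0" "d < u r"
proof -
  have "\<exists>r\<in>A. r < r0 \<and> d < u r"
  proof (rule ccontr)
    assume none: "\<not> ?thesis"
    have "eventually (\<lambda>y. y < ereal r0) (at_right a)"
      using assms(2) eventually_at_right[of a "ereal r0"] by blast
    then have "eventually (\<lambda>x. x < r0) (filtercomap ereal (at_right a))"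
      unfolding eventually_filtercomap by (intro exI[of _ "\<lambda>y. y < ereal r0"]) simp
    then have "eventually (\<lambda>x. x \<in> A \<longrightarrow> ereal (u x) \<le> ereal d) (filtercomap ereal (at_right a))"
      by eventually_elim (use none in \<open>auto simp: not_less\<close>)
    then have "Limsup (inf (filtercomap ereal (at_right a)) (principal A)) (\<lambda>x. ereal (u x)) \<le> ereal d"
      by (intro Limsup_bounded) (simp add: eventually_inf_principal)
    with assms(1) show False by simp
  qed
  then show thesis using that by blast
qed

lemma nn_integral_set_mono:
  fixes w :: "real \<Rightarrow> ennreal"
  assumes "S \<subseteq> S'"
  shows "(\<integral>\<^sup>+ x \<in> S. w x \<partial>lebesgue) \<le> (\<integral>\<^sup>+ x \<in> S'. w x \<partial>lebesgue)"
  using assms by (intro nn_integral_mono) (auto simp: indicator_def)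

context weight
begin

lemma integrand_measurable:
  assumes f_diff: "\<And>x. x \<in> {r..R} \<Longrightarrow> f differentiable (at x)"
    and AC: "AC_on {r..R} (deriv f)"
  shows "(\<lambda>x. ennreal (\<bar>deriv f x\<bar> powr p * h \<bar>f x\<bar>) * indicator ({r..R} \<inter> {x. f x \<noteq> 0}) x)
     \<in> borel_measurable lebesgue"
proof -
  have "continuous_on {r..R} f"
    using f_diff by (intro continuous_at_imp_continuous_on ballI differentiable_imp_continuous_within) blast
  then have f_meas: "f \<in> borel_measurable (lebesgue_on {r..R})"
    by (rule continuous_imp_measurable_on_sets_lebesgue) simp
  have [measurable]: "deriv f \<in> borel_measurable (lebesgue_on {r..R})"
    by (rule continuous_imp_measurable_on_sets_lebesgue[OF AC_on_imp_continuous_on[OF AC]]) simp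
  have [measurable]: "(\<lambda>x. if f x \<noteq> 0 then h \<bar>f x\<bar> else 0) \<in> borel_measurable (lebesgue_on {r..R})"
    by (rule measurable_compose[OF f_meas borel_measurable_extend_zero[OF h_cont]])
  have "(\<lambda>x. ennreal (\<bar>deriv f x\<bar> powr p * (if f x \<noteq> 0 then h \<bar>f x\<bar> else 0)))
      \<in> borel_measurable (lebesgue_on {r..R})" by measurable
  then have "(\<lambda>x. ennreal (\<bar>deriv f x\<bar> powr p * (if f x \<noteq> 0 then h \<bar>f x\<bar> else 0)) * indicator {r..R} x)
      \<in> borel_measurable lebesgue"
    by (subst (asm) borel_measurable_restrict_space_iff_ennreal) simp_all
  also have "(\<lambda>x. ennreal (\<bar>deriv f x\<bar> powr p * (if f x \<noteq> 0 then h \<bar>f x\<bar> else 0)) * indicator {r..R} x)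
     = (\<lambda>x. ennreal (\<bar>deriv f x\<bar> powr p * h \<bar>f x\<bar>) * indicator ({r..R} \<inter> {x. f x \<noteq> 0}) x)"
    by (auto simp: fun_eq_iff indicator_def)
  finally show ?thesis .
qed

text \<open>
  The boundary condition yields end points arbitrarily close to \<open>a\<close> and \<open>b\<close> at which the difference of the
  boundary terms is at most a prescribed \<open>\<eta> > 0\<close>.
\<close>

theorem global_estimate:
  assumes ab: "a < b" and f: "f \<in> R_class p h H a b"
  shows "(\<integral>\<^sup>+ x \<in> einterval a b \<inter> {x. f x \<noteq> 0}. ennreal (\<bar>deriv f x\<bar> powr p * h \<bar>f x\<bar>) \<partial>lebesgue)
     \<le> ennreal ((p - 1) powr (p / 2)) *
        (\<integral>\<^sup>+ x \<in> einterval a b \<inter> {x. f x \<noteq> 0}. ennreal (rhs_density (deriv (deriv f) x) \<bar>f x\<bar>) \<partial>lebesgue)"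
    (is "?A \<le> ennreal ?K * ?B")
proof (cases "?B = \<infinity>")
  case True
  have "?K > 0" using p by simp
  then show ?thesis unfolding True by (simp add: ennreal_mult_top)
next
  case False
  define B where "B = enn2real ?B"
  have B: "?B = ennreal B" "B \<ge> 0" using False by (simp_all add: B_def less_top)
  define k where "k = (\<lambda>x. ennreal (\<bar>deriv f x\<bar> powr p * h \<bar>f x\<bar>))"
  have f_diff: "f differentiable (at x)" if "x \<in> einterval a b" for x
    using f that by (simp add: R_class_def W21_loc_def)
  have sub: "{r..R} \<subseteq> einterval a b" if "a < ereal r" "ereal R < b" for r R
  proof
    fix x assume "x \<in> {r..R}"
    then have "ereal r \<le> ereal x" "ereal x \<le> ereal R" by auto
    then have "a < ereal x" "ereal x < b"
      using that by (blast intro: less_le_trans le_less_trans)+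
    then show "x \<in> einterval a b" by (simp add: einterval_def)
  qed
  have AC: "AC_on {r..R} (deriv f)" if "a < ereal r" "ereal R < b" "r \<le> R" for r R
    using f sub[OF that(1,2)] that(3) by (simp add: R_class_def W21_loc_def locally_AC_on_def)
  obtain \<epsilon> where \<epsilon>: "\<epsilon> > 0" and G_fin: "\<And>r R. a < ereal r \<Longrightarrow> r < R \<Longrightarrow> ereal R < b \<Longrightarrow>
      (\<integral>\<^sup>+ x \<in> {r<..<R} \<inter> {x. 0 < \<bar>f x\<bar> \<and> \<bar>f x\<bar> < \<epsilon>}.
              ennreal (\<bar>deriv f x\<bar> powr p * G \<bar>f x\<bar>) \<partial>lebesgue) < \<infinity>"
    using f unfolding R_class_def G_def by blast
  have limits: "Liminf (inf (filtercomap ereal (at_left b)) (principal (A_set a b f))) (\<lambda>R. ereal (bdry_term f R))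
      - Limsup (inf (filtercomap ereal (at_right a)) (principal (A_set a b f))) (\<lambda>r. ereal (bdry_term f r)) \<le> 0"
    using f unfolding R_class_def boundary_term_eq by blast
  have compact_bound: "(\<integral>\<^sup>+ x \<in> {r0..R0} \<inter> {x. f x \<noteq> 0}. k x \<partial>lebesgue) \<le> ennreal (p / 2 * \<eta> + ?K * B)"
    if r0: "a < ereal r0" and R0: "ereal R0 < b" and "r0 < R0" and "\<eta> > 0" for r0 R0 \<eta>
  proof -
    obtain c d where cd: "Liminf (inf (filtercomap ereal (at_left b)) (principal (A_set a b f))) (\<lambda>R. ereal (bdry_term f R)) < ereal c"
        "ereal d < Limsup (inf (filtercomap ereal (at_right a)) (principal (A_set a b f))) (\<lambda>r. ereal (bdry_term f r))"
        "c - d \<le> \<eta>"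
      by (rule ereal_separating_reals[OF limits \<open>\<eta> > 0\<close>])
    obtain R where R: "R \<in> A_set a b f" "R0 < R" "bdry_term f R < c"
      by (rule Liminf_at_left_less[OF cd(1) R0])
    obtain r where r: "r \<in> A_set a b f" "r < r0" "d < bdry_term f r"
      by (rule Limsup_at_right_greater[OF cd(2) r0])
    have rR: "r < R" "a < ereal r" "ereal R < b"
      using r R \<open>r0 < R0\<close> by (auto simp: A_set_def einterval_def)
    obtain r' where r': "a < ereal r'" "r' < r" using ereal_dense2[OF rR(2)] by auto
    obtain R' where R': "R < R'" "ereal R' < b" using ereal_dense2[OF rR(3)] by auto
    have fin_B: "(\<integral>\<^sup>+ x \<in> {r..R} \<inter> {x. f x \<noteq> 0}. ennreal (rhs_density (deriv (deriv f) x) \<bar>f x\<bar>) \<partial>lebesgue) \<le> ?B"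
      using sub[OF rR(2,3)] by (intro nn_integral_set_mono) blast
    have fin_G: "(\<integral>\<^sup>+ x \<in> {r..R} \<inter> {x. 0 < \<bar>f x\<bar> \<and> \<bar>f x\<bar> < \<epsilon>}. ennreal (\<bar>deriv f x\<bar> powr p * G \<bar>f x\<bar>) \<partial>lebesgue) < \<infinity>"
    proof (rule le_less_trans[OF nn_integral_set_mono G_fin])
      show "{r..R} \<inter> {x. 0 < \<bar>f x\<bar> \<and> \<bar>f x\<bar> < \<epsilon>} \<subseteq> {r'<..<R'} \<inter> {x. 0 < \<bar>f x\<bar> \<and> \<bar>f x\<bar> < \<epsilon>}"
        using r' R' by auto
    qed (use r' R' rR in auto)
    have "(\<integral>\<^sup>+ x \<in> {r0..R0} \<inter> {x. f x \<noteq> 0}. k x \<partial>lebesgue) \<le> (\<integral>\<^sup>+ x \<in> {r..R} \<inter> {x. f x \<noteq> 0}. k x \<partial>lebesgue)"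
      using r(2) R(2) by (intro nn_integral_set_mono) auto
    also have "\<dots> \<le> ennreal (p / 2 * (bdry_term f R - bdry_term f r) + ?K *
        enn2real (\<integral>\<^sup>+ x \<in> {r..R} \<inter> {x. f x \<noteq> 0}. ennreal (rhs_density (deriv (deriv f) x) \<bar>f x\<bar>) \<partial>lebesgue))"
      unfolding k_def
    proof (rule local_estimate[OF rR(1) _ _ \<epsilon> fin_G])
      show "f differentiable (at x)" if "x \<in> {r..R}" for x
        using sub[OF rR(2,3)] that by (intro f_diff) blast
      show "AC_on {r..R} (deriv f)" using rR by (intro AC) auto
      show "(\<integral>\<^sup>+ x \<in> {r..R} \<inter> {x. f x \<noteq> 0}. ennreal (rhs_density (deriv (deriv f) x) \<bar>f x\<bar>) \<partial>lebesgue) < \<infinity>"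
        using fin_B unfolding B(1) by (rule le_less_trans) simp
    qed
    also have "\<dots> \<le> ennreal (p / 2 * \<eta> + ?K * B)"
    proof (intro ennreal_leI add_mono mult_left_mono)
      show "bdry_term f R - bdry_term f r \<le> \<eta>" using R(3) r(3) cd(3) by linarith
      show "enn2real (\<integral>\<^sup>+ x \<in> {r..R} \<inter> {x. f x \<noteq> 0}. ennreal (rhs_density (deriv (deriv f) x) \<bar>f x\<bar>) \<partial>lebesgue) \<le> B"
        unfolding B_def using fin_B False by (intro enn2real_mono) (simp_all add: less_top)
    qed (use p in auto)
    finally show ?thesis .
  qed
  obtain u l :: "nat \<Rightarrow> real" where ul: "einterval a b = (\<Union>i. {l i .. u i})" "incseq u" "decseq l"
      "\<And>i. l i < u i" "\<And>i. a < l i" "\<And>i. u i < b" "l \<longlonglongrightarrow> a" "u \<longlonglongrightarrow> b"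
    by (blast intro: einterval_Icc_approximation[OF ab])
  have mono: "{l i..u i} \<subseteq> {l j..u j}" if "i \<le> j" for i j
    using that ul(2,3) by (auto simp: incseq_def decseq_def intro: order_trans)
  have A_eq: "?A = (SUP n. \<integral>\<^sup>+ x \<in> {l n..u n} \<inter> {x. f x \<noteq> 0}. k x \<partial>lebesgue)"
  proof -
    have "(SUP n. k x * indicator ({l n..u n} \<inter> {x. f x \<noteq> 0}) x) = k x * indicator (einterval a b \<inter> {x. f x \<noteq> 0}) x" for x
    proof (cases "x \<in> einterval a b \<inter> {x. f x \<noteq> 0}")
      case True
      then obtain n where "x \<in> {l n..u n}" using ul(1) by auto
      then have n: "x \<in> {l n..u n} \<inter> {x. f x \<noteq> 0}" using True by blast
      show ?thesis
      proof (rule antisym)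
        show "(SUP n. k x * indicator ({l n..u n} \<inter> {x. f x \<noteq> 0}) x) \<le> k x * indicator (einterval a b \<inter> {x. f x \<noteq> 0}) x"
          using True by (intro SUP_least) (auto simp: indicator_def)
        show "k x * indicator (einterval a b \<inter> {x. f x \<noteq> 0}) x \<le> (SUP n. k x * indicator ({l n..u n} \<inter> {x. f x \<noteq> 0}) x)"
          by (rule SUP_upper2[of n]) (use n True in \<open>auto simp: indicator_def\<close>)
      qed
    next
      case False
      then have "x \<notin> {l n..u n} \<inter> {x. f x \<noteq> 0}" for n using ul(1) by auto
      with False show ?thesis by (simp only: indicator_simps mult_zero_right cSUP_const UNIV_not_empty not_False_eq_True)
    qed
    then have "?A = (\<integral>\<^sup>+ x. (SUP n. k x * indicator ({l n..u n} \<inter> {x. f x \<noteq> 0}) x) \<partial>lebesgue)"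
      by (simp add: k_def)
    also have "\<dots> = (SUP n. \<integral>\<^sup>+ x \<in> {l n..u n} \<inter> {x. f x \<noteq> 0}. k x \<partial>lebesgue)"
    proof (rule nn_integral_monotone_convergence_SUP)
      show "incseq (\<lambda>n x. k x * indicator ({l n..u n} \<inter> {x. f x \<noteq> 0}) x)"
        using mono by (fastforce simp: incseq_def le_fun_def indicator_def)
      show "(\<lambda>x. k x * indicator ({l n..u n} \<inter> {x. f x \<noteq> 0}) x) \<in> borel_measurable lebesgue" for n
        unfolding k_def
      proof (rule integrand_measurable)
        show "f differentiable (at x)" if "x \<in> {l n..u n}" for x
          using ul(1) that by (intro f_diff) blast
        show "AC_on {l n..u n} (deriv f)" using ul(4-6)[of n] by (intro AC) auto
      qed
    qed
    finally show ?thesis .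
  qed
  have "?A \<le> ennreal (?K * B)"
  proof (rule ennreal_le_epsilon)
    \<comment> \<open>The choice \<open>\<eta> = 2 * e / p\<close> turns the term with \<open>\<eta>\<close> into \<open>e\<close>.\<close>
    fix e :: real assume "e > 0"
    have "?A \<le> ennreal (p / 2 * (2 * e / p) + ?K * B)"
      unfolding A_eq using ul(4-6) p \<open>e > 0\<close> by (intro SUP_least compact_bound) auto
    also have "\<dots> = ennreal (?K * B) + ennreal e"
      using p \<open>e > 0\<close> B(2) by (simp add: add.commute flip: ennreal_plus)
    finally show "?A \<le> ennreal (?K * B) + ennreal e" .
  qed
  also have "\<dots> = ennreal ?K * ?B" using B by (simp add: ennreal_mult)
  finally show ?thesis .
qed

end

theorem proposition5p3:
  fixes p :: real and a b :: ereal and h H :: "real \<Rightarrow> real"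
  assumes p: "p \<ge> 2"
    and ab: "a < b"
    and h_cont: "continuous_on {0<..} h"
    and h_pos: "\<And>l. l > 0 \<Longrightarrow> h l > 0"
    and H: "AC_primitive_on {0<..} h H"
    and i_h: "bounded_near_0 h \<or> nonincreasing_near_0 h"
    and i_Th: "bounded_near_0 (\<lambda>l. \<bar>T_trans h H l\<bar> powr (p / 2) * h l)
                 \<or> nonincreasing_near_0 (\<lambda>l. \<bar>T_trans h H l\<bar> powr (p / 2) * h l)"
    and ii: "\<not> nonincreasing_near_0 (\<lambda>l. \<bar>T_trans h H l\<bar> powr (p / 2) * h l)
               \<Longrightarrow> nonincreasing_near_0 (G_fun p h H) \<or> bounded_near_0 (G_fun p h H)"
  shows "\<forall>f \<in> R_class p h H a b.
     (\<integral>\<^sup>+ x \<in> einterval a b \<inter> {x. f x \<noteq> 0}.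
        ennreal (\<bar>deriv f x\<bar> powr p * h \<bar>f x\<bar>) \<partial>lebesgue)
     \<le> ennreal (sqrt (p - 1) powr p) *
        (\<integral>\<^sup>+ x \<in> einterval a b \<inter> {x. f x \<noteq> 0}.
           ennreal (\<bar>deriv (deriv f) x * T_trans h H \<bar>f x\<bar>\<bar> powr (p / 2) * h \<bar>f x\<bar>) \<partial>lebesgue)"
proof -
  interpret weight p h H
    using p h_cont h_pos AC_primitive_on_has_derivative[OF H h_cont] by unfold_locales auto
  have "sqrt (p - 1) powr p = (p - 1) powr (p / 2)"
    using p by (simp add: powr_half_sqrt[symmetric] powr_powr)
  then show ?thesis
    using global_estimate[OF ab] unfolding rhs_density_def T_def by simp
qed

end
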